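(* Let $n\ge2$, let $V$ be an open neighbourhood of $0$ in $\mathbb{R}^n$ and $U$ an open neighbourhood of $0$ in $\mathbb{R}^{n-1}$. For $1\le j\le n$ let $\pi_j:V\to U$ be a $C^1$ submersion onto $U$, and for $x\in V$ let $\omega_j(x)$ be the wedge product of the rows of $d\pi_j(x)$. Assume that $\omega_1(0)\wedge\dots\wedge\omega_n(0)\ne0$. Then for every $\epsilon>0$ there is a neighbourhood $V'\subseteq V$ of $0$ such that for all nonnegative measurable functions $f_1,\dots,f_n$ on $U$, $$\int_{V'}\prod_{j=1}^n f_j(\pi_jx)^{1/(n-1)}\,dx\le(1+\epsilon)\,\big(\omega_1(0)\wedge\dots\wedge\omega_n(0)\big)^{-1/(n-1)}\prod_{j=1}^n\left(\int_U f_j\right)^{1/(n-1)}.$$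
   Context: The wedge product of $n-1$ row vectors in $\mathbb{R}^n$ is identified with a vector in $\mathbb{R}^n$ in the usual way (generalised cross product). For vectors $\omega_1,\dots,\omega_n\in\mathbb{R}^n$, $\omega_1\wedge\dots\wedge\omega_n$ denotes the modulus of the determinant of the matrix with columns $\omega_1,\dots,\omega_n$. *)

theory Defs
  imports "HOL-Analysis.Analysis"
begin

text \<open>
  Generalised cross product of the rows of an \<open>(n-1) \<times> n\<close> matrix, where \<open>n = CARD('n)\<close> and
  \<open>n - 1 = CARD('m)\<close>: its \<open>k\<close>-th coordinate is the determinant of the square matrix whose rows are
  the \<open>k\<close>-th standard basis vector followed by the rows of \<open>A\<close>.  Stacking these rows into a square
  matrix needs an enumeration of \<open>'n\<close> by one extra index together with \<open>'m\<close>. A different choice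
  permutes the rows of all these determinants alike, so it changes the result at most by a sign
  common to all coordinates and all \<open>A\<close>.
\<close>

definition row_enum :: "'m::finite option \<Rightarrow> 'n::finite" where
  "row_enum = (SOME e. bij e)"

definition wedge_rows :: "real ^ 'n ^ 'm \<Rightarrow> real ^ 'n" where
  "wedge_rows A =
     (\<chi> k. det (\<chi> i. case inv (row_enum :: 'm option \<Rightarrow> 'n) i of
                       None \<Rightarrow> axis k 1
                     | Some a \<Rightarrow> A $ a))"

definition wedge_modulus :: "('n \<Rightarrow> real ^ 'n) \<Rightarrow> real" where
  "wedge_modulus w = \<bar>det (\<chi> i j. w j $ i)\<bar>"

definition C1_submersion_on :: "(real ^ 'n \<Rightarrow> real ^ 'm) \<Rightarrow> (real ^ 'n) set \<Rightarrow> bool" where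
  "C1_submersion_on p V \<longleftrightarrow>
     (\<forall>x\<in>V. p differentiable (at x)) \<and>
     continuous_on V (\<lambda>x. jacobian p (at x)) \<and>
     (\<forall>x\<in>V. surj (frechet_derivative p (at x)))"

text \<open>Powers of extended nonnegative reals, meant for exponents \<open>p > 0\<close>.\<close>

definition ennreal_powr :: "ennreal \<Rightarrow> real \<Rightarrow> ennreal" where
  "ennreal_powr a p = (if a = top then top else ennreal (enn2real a powr p))"

end

theory Submission
  imports Defs
begin

text \<open>
The inequality has an elementary proof by Cauchy--Schwarz and its multilinear relatives, in which
the fibres of the \<open>\<pi>\<^sub>j\<close> are used only through walks along them. Write \<open>m = n - 1\<close>, let
\<open>V\<close> stand for a small ball around \<open>0\<close>, and fix \<open>f\<^sub>1, \<dots>, f\<^sub>n \<ge> 0\<close>.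

For \<open>n = 3\<close> the idea is already visible. Two points \<open>x, x'\<close> of the same fibre of \<open>\<pi>\<^sub>3\<close> form a
four-dimensional family, and \<open>(x, x') \<mapsto> (\<pi>\<^sub>1 x, \<pi>\<^sub>2 x')\<close> maps this family to \<open>\<real>\<^sup>2 \<times> \<real>\<^sup>2\<close>. For linear
\<open>\<pi>\<^sub>j\<close> that map is a linear isomorphism; a small \<open>C\<^sup>1\<close> perturbation of it is still injective and distorts
volume by a factor close to that of the linear map. So the integral of \<open>f\<^sub>1 (\<pi>\<^sub>1 x) f\<^sub>2 (\<pi>\<^sub>2 x')\<close> over the family is
at most a constant near that of the linear case times \<open>\<integral>f\<^sub>1 \<integral>f\<^sub>2\<close>. By Cauchy--Schwarz, once along the
fibres of \<open>\<pi>\<^sub>3\<close> and once over the space of fibres, it is also, up to a factor near \<open>1\<close>, at least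
\<open>(\<integral> (f\<^sub>1(\<pi>\<^sub>1 x) f\<^sub>2(\<pi>\<^sub>2 x) f\<^sub>3(\<pi>\<^sub>3 x))\<^sup>1\<^sup>/\<^sup>2 dx)\<^sup>2 / \<integral>f\<^sub>3\<close>. No smallness beyond
closeness of the differentials is involved, which is why \<open>C\<^sup>1\<close> suffices and why the constant
tends to that of the linear case as the ball shrinks.

For general \<open>n\<close> pairs are replaced by walks \<open>x\<^sub>1, \<dots>, x\<^sub>m\<close> whose successive points lie on common fibres of
\<open>n - 2\<close> different \<open>\<pi>\<^sub>j\<close>. Let \<open>T\<^sub>j h (x)\<close> be the integral of \<open>h\<close> along the fibre of \<open>\<pi>\<^sub>j\<close> through
\<open>x\<close>, which is a function of \<open>\<pi>\<^sub>j x\<close>.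

  \<^item> Lower bound (\<open>integral_power_le_walk\<close>): by induction on the number of steps \<open>k\<close>, the
    integral of \<open>A \<sqdot> T\<^bsub>j(1)\<^esub> \<dots> T\<^bsub>j(k)\<^esub> B\<close> is, up to constants near \<open>1\<close>, at least
    \<open>(\<integral> (A B \<Prod>\<^sub>i f\<^bsub>j(i)\<^esub> \<circ> \<pi>\<^bsub>j(i)\<^esub>)\<^sup>1\<^sup>/\<^sup>(\<^sup>k\<^sup>+\<^sup>1\<^sup>))\<^sup>k\<^sup>+\<^sup>1 / \<Prod>\<^sub>i \<integral>f\<^bsub>j(i)\<^esub>\<close>. One step uses that
    \<open>T\<^sub>j\<close> is almost self-adjoint together with one application of Hoelder's inequality
    (\<open>hoelder_power\<close>).
  \<^item> Upper bound (\<open>walk_le\<close>): walking once along each of the \<open>m\<close> families other than the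
    \<open>k\<close>-th and then applying \<open>\<pi>\<^sub>k\<close> is a near-linear map of the \<open>m\<close> walking parameters into
    \<open>\<real>\<^sup>m\<close>, with the volume factor of the linear model. So the iterated fibre integral of
    \<open>f\<^sub>k \<circ> \<pi>\<^sub>k\<close> is at most a constant near \<open>1 / (\<omega>\<^sub>1(0) \<and> \<dots> \<and> \<omega>\<^sub>n(0))\<close> times \<open>\<integral>f\<^sub>k\<close>.

Taking \<open>A = f\<^sub>i \<circ> \<pi>\<^sub>i\<close> and \<open>B = f\<^sub>k \<circ> \<pi>\<^sub>k\<close> and walking along the remaining \<open>n - 2\<close> families combines the
two bounds (\<open>loomis_whitney_power\<close>). All changes of variables are handled by one lemma
(\<open>nn_integral_expanding\<close>): a map which expands distances by at least \<open>1 / K\<close> satisfies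
\<open>\<integral> h \<circ> g \<le> K\<^sup>d \<integral> h\<close>. It only needs estimates on differences, so determinants enter only through
linear maps. These are normalised by taking the vectors \<open>l\<^sub>j\<close> dual to the \<open>\<omega>\<^sub>j(0)\<close>: then
\<open>x \<mapsto> (d\<pi>\<^sub>j(0) x, l\<^sub>j \<bullet> x)\<close> has determinant \<open>\<plusminus>1\<close>, because the determinant of the rows of
\<open>d\<pi>\<^sub>j(0)\<close> together with \<open>v\<close> is \<open>v \<bullet> \<omega>\<^sub>j(0)\<close>.
\<close>

section \<open>Distance-expanding maps and Lebesgue measure\<close>

lemma emeasure_UN_countable_subadditive:
  assumes X: "\<And>i. i \<in> I \<Longrightarrow> X i \<in> sets M" and I: "countable I"
  shows "emeasure M (\<Union>i\<in>I. X i) \<le> (\<integral>\<^sup>+i. emeasure M (X i) \<partial>count_space I)"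
proof -
  have "emeasure M (\<Union>i\<in>I. X i) = (\<integral>\<^sup>+x. indicator (\<Union>i\<in>I. X i) x \<partial>M)"
    using X I by (intro nn_integral_indicator[symmetric] sets.countable_UN'') auto
  also have "\<dots> \<le> (\<integral>\<^sup>+x. \<integral>\<^sup>+i. indicator (X i) x \<partial>count_space I \<partial>M)"
    by (intro nn_integral_mono)
       (auto split: split_indicator intro!: order_trans[OF _ nn_integral_ge_point])
  also have "\<dots> = (\<integral>\<^sup>+i. \<integral>\<^sup>+x. indicator (X i) x \<partial>M \<partial>count_space I)"
    using X I by (intro nn_integral_count_space_nn_integral) auto
  also have "\<dots> = (\<integral>\<^sup>+i. emeasure M (X i) \<partial>count_space I)"
    using X by (intro nn_integral_cong) simp
  finally show ?thesis .
qed

text \<open>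
The Lipschitz inverse of \<open>g\<close> maps a ball of radius \<open>r\<close> into one of radius \<open>K r\<close>, which costs exactly
the factor \<open>K ^ d\<close>; Vitali's theorem covers almost all of \<open>E \<inter> g ` S\<close> by disjoint balls inside an open
set of almost the same measure, and the null set that remains stays null. Balls rather than boxes are
essential here, since they give the constant without loss. Domain and codomain may be different types
because products such as \<open>\<real>\<^sup>m \<times> \<real>\<close> are compared with \<open>\<real>\<^sup>n\<close> below.
\<close>

lemma emeasure_vimage_expanding:
  fixes g :: "'a::euclidean_space \<Rightarrow> 'b::euclidean_space"
  assumes dim: "DIM('a) = DIM('b)"
    and S: "S \<in> sets borel" and g: "g \<in> borel_measurable borel" and E: "E \<in> sets borel"
    and K: "K > 0"
    and expand: "\<And>x y. x \<in> S \<Longrightarrow> y \<in> S \<Longrightarrow> norm (x - y) \<le> K * norm (g x - g y)"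
  shows "emeasure lborel (g -` E \<inter> S) \<le> ennreal (K ^ DIM('a)) * emeasure lborel E"
proof (cases "emeasure lborel E = \<infinity>")
  case True
  then show ?thesis
    using K by (simp add: ennreal_mult_top)
next
  case False
  let ?d = "DIM('a)"
  let ?D = "g -` E \<inter> S"
  have D[measurable]: "?D \<in> sets borel"
    using measurable_sets[OF g E] S by auto
  have inj: "inj_on g S"
  proof (rule inj_onI)
    fix x y assume "x \<in> S" "y \<in> S" "g x = g y"
    with expand[of x y] show "x = y" by simp
  qed
  define h where "h = inv_into S g"
  have h_in: "h y \<in> S" and gh: "g (h y) = y" if "y \<in> g ` S" for y
    using that unfolding h_def by (auto intro: inv_into_into f_inv_into_f)
  have "emeasure lborel ?D \<le> ennreal (K ^ ?d) * emeasure lborel E + ennreal (K ^ ?d) * ennreal e"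
    if "e > 0" for e
  proof -
    obtain U where U: "open U" "E \<subseteq> U" "emeasure lborel (U - E) < e"
      using outer_regular_lborel[OF E \<open>e > 0\<close>] by blast
    have "U \<in> sets borel"
      using U(1) by simp
    have "emeasure lborel U = emeasure lborel E + emeasure lborel (U - E)"
      using U(2) E \<open>U \<in> sets borel\<close>
      by (subst plus_emeasure) (auto simp: Un_absorb1)
    then have UE: "emeasure lborel U \<le> emeasure lborel E + ennreal e"
      using U(3) by (simp add: order.strict_implies_order)
    let ?T = "E \<inter> g ` S"
    let ?I = "{(c, r). c \<in> ?T \<and> 0 < r \<and> ball c r \<subseteq> U}"
    have "\<exists>i. i \<in> ?I \<and> x \<in> ball (fst i) (snd i) \<and> snd i < d" if x: "x \<in> ?T" and "0 < d" for x d
    proof -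
      have "x \<in> U" using x U(2) by auto
      then obtain r where r: "r > 0" "ball x r \<subseteq> U"
        using U(1) openE by blast
      have "ball x (min r (d/2)) \<subseteq> U"
        using r by auto
      with r x \<open>0 < d\<close> show ?thesis
        by (intro exI[of _ "(x, min r (d/2))"]) auto
    qed
    \<comment> \<open>Centres are kept on the image of S, so that the inverse of g sends each of them to a point of S.\<close>
    then obtain C where C: "countable C" "C \<subseteq> ?I"
      and disj: "pairwise (\<lambda>i j. disjnt (ball (fst i) (snd i)) (ball (fst j) (snd j))) C"
      and neg: "negligible (?T - (\<Union>i\<in>C. ball (fst i) (snd i)))"
      by (rule Vitali_covering_theorem_balls) blast
    let ?N = "?T - (\<Union>i\<in>C. ball (fst i) (snd i))"
    have "negligible (h ` ?N)"
    proof (rule negligible_locally_Lipschitz_image)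
      show "DIM('b) \<le> DIM('a)" using dim by simp
      show "negligible ?N" by (fact neg)
      show "\<exists>T B. open T \<and> x \<in> T \<and> (\<forall>y\<in>?N \<inter> T. norm (h y - h x) \<le> B * norm (y - x))"
        if "x \<in> ?N" for x
        using that expand h_in gh
        by (intro exI[of _ UNIV] exI[of _ K]) (metis Diff_iff IntD1 IntD2 UNIV_I open_UNIV)
    qed
    then obtain Z where Z: "Z \<in> null_sets lborel" "h ` ?N \<subseteq> Z"
      unfolding negligible_iff_null_sets null_sets_completion_iff2 by blast
    have "?D \<subseteq> (\<Union>i\<in>C. ball (h (fst i)) (K * snd i)) \<union> Z"
    proof
      fix x assume x: "x \<in> ?D"
      then have hx: "h (g x) = x"
        unfolding h_def using inj by auto
      have gx: "g x \<in> ?T" using x by auto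
      show "x \<in> (\<Union>i\<in>C. ball (h (fst i)) (K * snd i)) \<union> Z"
      proof (cases "g x \<in> ?N")
        case True
        then have "h (g x) \<in> Z" using Z(2) by blast
        then show ?thesis using hx by simp
      next
        case False
        then obtain i where i: "i \<in> C" "g x \<in> ball (fst i) (snd i)"
          using gx by auto
        then have fi: "fst i \<in> g ` S" using C(2) by auto
        have "norm (h (fst i) - x) \<le> K * norm (fst i - g x)"
          using expand[OF h_in[OF fi], of x] x gh[OF fi] by auto
        also have "\<dots> < K * snd i"
          using i(2) K by (simp add: dist_norm)
        finally show ?thesis using i(1) by (auto simp: dist_norm)
      qed
    qed
    then have "emeasure lborel ?D \<le> emeasure lborel ((\<Union>i\<in>C. ball (h (fst i)) (K * snd i)) \<union> Z)"
      using Z(1) C(1) by (intro emeasure_mono sets.Un) (auto intro!: sets.countable_UN'')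
    also have "\<dots> = emeasure lborel (\<Union>i\<in>C. ball (h (fst i)) (K * snd i))"
      using Z(1) C(1) by (intro emeasure_Un_null_set) (auto intro!: sets.countable_UN'')
    also have "\<dots> \<le> (\<integral>\<^sup>+i. emeasure lborel (ball (h (fst i)) (K * snd i)) \<partial>count_space C)"
      using C(1) by (intro emeasure_UN_countable_subadditive) auto
    also have "\<dots> = (\<integral>\<^sup>+i. ennreal (K ^ ?d) * emeasure lborel (ball (fst i) (snd i)) \<partial>count_space C)"
    proof (rule nn_integral_cong)
      fix i assume "i \<in> space (count_space C)"
      then have "snd i > 0" using C(2) by auto
      then show "emeasure lborel (ball (h (fst i)) (K * snd i))
          = ennreal (K ^ ?d) * emeasure lborel (ball (fst i) (snd i))"
        using K dim by (simp add: emeasure_ball ennreal_mult'[symmetric] power_mult_distrib mult_ac)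
    qed
    also have "\<dots> = ennreal (K ^ ?d) * (\<integral>\<^sup>+i. emeasure lborel (ball (fst i) (snd i)) \<partial>count_space C)"
      by (rule nn_integral_cmult) simp
    also have "(\<integral>\<^sup>+i. emeasure lborel (ball (fst i) (snd i)) \<partial>count_space C)
        = emeasure lborel (\<Union>i\<in>C. ball (fst i) (snd i))"
      using C(1) disj
      by (intro emeasure_UN_countable[symmetric]) (auto simp: disjoint_family_on_def pairwise_def disjnt_def)
    also have "\<dots> \<le> emeasure lborel U"
      using C(2) \<open>U \<in> sets borel\<close> by (intro emeasure_mono) fastforce+
    also have "ennreal (K ^ ?d) * \<dots> \<le> ennreal (K ^ ?d) * (emeasure lborel E + ennreal e)"
      using UE by (intro mult_left_mono) auto
    finally show ?thesis
      by (simp add: mult_left_mono distrib_left)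
  qed
  note bound = this
  show ?thesis
  proof (rule ennreal_le_epsilon)
    fix e :: real assume "0 < e"
    have "emeasure lborel ?D \<le> ennreal (K ^ ?d) * emeasure lborel E + ennreal (K ^ ?d) * ennreal (e / K ^ ?d)"
      using bound[of "e / K ^ ?d"] K \<open>0 < e\<close> by simp
    also have "ennreal (K ^ ?d) * ennreal (e / K ^ ?d) = ennreal e"
      using K \<open>0 < e\<close> by (simp add: ennreal_mult'[symmetric])
    finally show "emeasure lborel ?D \<le> ennreal (K ^ ?d) * emeasure lborel E + ennreal e" .
  qed
qed

text \<open>
The change of variables used throughout. It is one-sided and has no Jacobian, so it applies on any Borel
set \<open>S\<close>, with no differentiability and no knowledge of the shape of the image.
\<close>

lemma nn_integral_expanding:
  fixes g :: "'a::euclidean_space \<Rightarrow> 'b::euclidean_space"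
  assumes dim: "DIM('a) = DIM('b)"
    and S: "S \<in> sets borel" and g: "g \<in> borel_measurable borel"
    and K: "K > 0"
    and expand: "\<And>x y. x \<in> S \<Longrightarrow> y \<in> S \<Longrightarrow> norm (x - y) \<le> K * norm (g x - g y)"
    and h: "h \<in> borel_measurable borel"
  shows "(\<integral>\<^sup>+x. indicator S x * h (g x) \<partial>lborel) \<le> ennreal (K ^ DIM('a)) * (\<integral>\<^sup>+y. h y \<partial>lborel)"
proof -
  let ?M = "density lborel (indicator S)"
  have g': "g \<in> measurable ?M borel" using g by simp
  have le: "distr ?M borel g \<le> scale_measure (ennreal (K ^ DIM('a))) lborel"
  proof (subst le_measure, simp, rule ballI)
    fix E assume E: "E \<in> sets (distr ?M borel g)"
    show "emeasure (distr ?M borel g) E \<le> emeasure (scale_measure (ennreal (K ^ DIM('a))) lborel) E"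
    proof -
      have True: "E \<in> sets borel" using E by simp
      have "emeasure (distr ?M borel g) E = emeasure ?M (g -` E)"
        using g' True by (simp add: emeasure_distr)
      also have "\<dots> = emeasure lborel (g -` E \<inter> S)"
        using S measurable_sets[OF g True]
        by (subst emeasure_density)
           (auto simp: indicator_inter_arith[symmetric] Int_commute nn_integral_indicator[symmetric] simp del: nn_integral_indicator)
      finally show ?thesis
        using emeasure_vimage_expanding[OF dim S g True K expand] by simp
    qed
  qed
  have "(\<integral>\<^sup>+x. indicator S x * h (g x) \<partial>lborel) = (\<integral>\<^sup>+y. h y \<partial>distr ?M borel g)"
    using S g h by (subst nn_integral_distr) (auto simp: nn_integral_density)
  also have "\<dots> \<le> (\<integral>\<^sup>+y. h y \<partial>scale_measure (ennreal (K ^ DIM('a))) lborel)"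
    by (intro nn_integral_mono_measure le) simp
  also have "\<dots> = ennreal (K ^ DIM('a)) * (\<integral>\<^sup>+y. h y \<partial>lborel)"
    using h by (intro nn_integral_scale_measure) simp
  finally show ?thesis .
qed

section \<open>Linear changes of variables in Cartesian space\<close>

lemma prod_Basis_cart:
  fixes f :: "real ^ 'n \<Rightarrow> 'c::comm_monoid_mult"
  shows "(\<Prod>b\<in>Basis. f b) = (\<Prod>i\<in>UNIV. f (axis i 1))"
proof -
  have B: "(Basis :: (real^'n) set) = range (\<lambda>i. axis i 1)"
    by (auto simp: Basis_vec_def)
  have "inj (\<lambda>i::'n. axis i (1::real))"
    by (simp add: inj_on_def axis_eq_axis)
  then show ?thesis
    unfolding B by (subst prod.reindex) (simp_all add: o_def)
qed

lemma borel_measurable_vec_lambda: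
  "(\<And>i. (\<lambda>x. f x i) \<in> borel_measurable M) \<Longrightarrow> (\<lambda>x. (\<chi> i. f x i) :: real ^ 'n) \<in> borel_measurable M"
  by (subst borel_measurable_euclidean_space) (auto simp: Basis_vec_def inner_axis)

lemma borel_measurable_vec_nth: "(\<lambda>x. (x :: real ^ 'n) $ i) \<in> borel_measurable borel"
  by (intro borel_measurable_continuous_onI continuous_intros)

lemma lborel_cart:
  "(lborel :: (real ^ 'n) measure) = distr (\<Pi>\<^sub>M i\<in>UNIV. lborel) borel (\<lambda>s. \<chi> i. s i)"
proof (rule lborel_eqI)
  interpret product_sigma_finite "\<lambda>_::'n. lborel :: real measure" ..
  fix l u :: "real ^ 'n" assume le: "\<And>b. b \<in> Basis \<Longrightarrow> l \<bullet> b \<le> u \<bullet> b"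
  then have le': "l $ i \<le> u $ i" for i
    using le[of "axis i 1"] by (simp add: inner_axis axis_in_Basis_iff)
  have meas: "(\<lambda>s. (\<chi> i. s i) :: real ^ 'n) \<in> measurable (\<Pi>\<^sub>M i\<in>UNIV. lborel) borel"
    by (intro borel_measurable_vec_lambda) measurable
  have "(\<lambda>s. \<chi> i. s i) -` box l u \<inter> space (\<Pi>\<^sub>M i\<in>(UNIV::'n set). lborel) = (\<Pi>\<^sub>E i\<in>UNIV. {l $ i<..<u $ i})"
    by (auto simp: mem_box_cart space_PiM PiE_def Pi_iff)
  then have "emeasure (distr (\<Pi>\<^sub>M i\<in>UNIV. lborel) borel (\<lambda>s. \<chi> i. s i)) (box l u)
      = (\<Prod>i\<in>UNIV. emeasure lborel {l $ i<..<u $ i})"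
    using meas by (simp add: emeasure_distr emeasure_PiM)
  also have "\<dots> = ennreal (\<Prod>i\<in>UNIV. u $ i - l $ i)"
    using le' by (simp add: prod_ennreal)
  finally show "emeasure (distr (\<Pi>\<^sub>M i\<in>UNIV. lborel) borel (\<lambda>s. \<chi> i. s i)) (box l u) = (\<Prod>b\<in>Basis. (u - l) \<bullet> b)"
    by (simp add: prod_Basis_cart inner_axis)
qed simp

lemma nn_integral_cart:
  fixes h :: "real ^ 'n \<Rightarrow> ennreal"
  assumes "h \<in> borel_measurable borel"
  shows "(\<integral>\<^sup>+x. h x \<partial>lborel) = (\<integral>\<^sup>+s. h (\<chi> i. s i) \<partial>(\<Pi>\<^sub>M i\<in>UNIV. lborel))"
  using assms
  by (subst lborel_cart, subst nn_integral_distr) (auto intro!: borel_measurable_vec_lambda)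

lemma nn_integral_cart_split:
  fixes h :: "real ^ 'n \<Rightarrow> ennreal"
  assumes h: "h \<in> borel_measurable borel"
  shows "(\<integral>\<^sup>+x. h x \<partial>lborel) =
    (\<integral>\<^sup>+s. \<integral>\<^sup>+t. h (\<chi> i. (s(k := t)) i) \<partial>lborel \<partial>(\<Pi>\<^sub>M i\<in>UNIV - {k}. lborel))"
proof -
  interpret product_sigma_finite "\<lambda>_::'n. lborel :: real measure" ..
  have "(\<lambda>s. h (\<chi> i. s i)) \<in> borel_measurable (\<Pi>\<^sub>M i\<in>UNIV. lborel)"
    by (intro measurable_compose[OF _ h] borel_measurable_vec_lambda) measurable
  then show ?thesis
    using h product_nn_integral_insert[of "UNIV - {k}" k "\<lambda>s. h (\<chi> i. s i)"]
    by (simp add: nn_integral_cart insert_absorb)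
qed

lemma borel_measurable_linear:
  fixes f :: "'a::euclidean_space \<Rightarrow> 'b::euclidean_space"
  shows "linear f \<Longrightarrow> f \<in> borel_measurable borel"
  by (intro borel_measurable_continuous_onI linear_continuous_on) (simp add: linear_conv_bounded_linear)

lemma nn_integral_isometry:
  fixes g :: "'a::euclidean_space \<Rightarrow> 'b::euclidean_space"
  assumes "DIM('a) = DIM('b)" and lin: "linear g" and iso: "\<And>x. norm (g x) = norm x"
    and h: "h \<in> borel_measurable borel"
  shows "(\<integral>\<^sup>+x. h (g x) \<partial>lborel) = (\<integral>\<^sup>+y. h y \<partial>lborel)"
proof -
  have "inj g"
    using lin iso by (metis linear_injective_0 norm_eq_zero)
  then have "surj g"
  proof -
    have "dim (range g) = DIM('b)"
      using dim_image_eq[OF lin, of UNIV] \<open>inj g\<close> assms(1) by (simp add: dim_UNIV)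
    then have "span (range g) = UNIV"
      by (simp add: dim_eq_full)
    moreover have "span (range g) = range g"
      using linear_subspace_image[OF lin subspace_UNIV] by (simp add: span_eq_iff)
    ultimately show ?thesis by simp
  qed
  obtain g' where g': "linear g'" "\<And>x. g' (g x) = x"
    using linear_injective_left_inverse[OF lin \<open>inj g\<close>] by (auto simp: fun_eq_iff)
  have gg': "g (g' y) = y" for y
    using \<open>surj g\<close> g'(2) by (metis surj_def)
  have meas: "g \<in> borel_measurable borel" "g' \<in> borel_measurable borel"
    using lin g'(1) by (auto intro: borel_measurable_linear)
  have iso': "norm (g' y) = norm y" for y
    by (metis iso gg')
  have 1: "(\<integral>\<^sup>+x. indicator UNIV x * h (g x) \<partial>lborel) \<le> ennreal (1 ^ DIM('a)) * (\<integral>\<^sup>+y. h y \<partial>lborel)"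
    using assms(1) meas h iso lin by (intro nn_integral_expanding) (auto simp flip: linear_diff)
  have "(\<lambda>x. h (g x)) \<in> borel_measurable borel"
    using meas h by simp
  then have 2: "(\<integral>\<^sup>+x. indicator UNIV x * h (g (g' x)) \<partial>lborel) \<le> ennreal (1 ^ DIM('b)) * (\<integral>\<^sup>+y. h (g y) \<partial>lborel)"
    using assms(1) meas iso' g'(1) by (intro nn_integral_expanding[where h="\<lambda>x. h (g x)"]) (auto simp flip: linear_diff)
  show ?thesis
    using 1 2 gg' by (intro antisym) auto
qed

text \<open>
As an inequality the statement also makes sense for singular \<open>f\<close>, which lets the induction over
elementary matrices run without case distinctions; equality for invertible matrices follows by applying
it to the inverse as well.
\<close>

lemma nn_integral_linear_le:
  fixes f :: "real ^ 'n \<Rightarrow> real ^ 'n"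
  assumes "linear f" and "h \<in> borel_measurable borel"
  shows "ennreal \<bar>det (matrix f)\<bar> * (\<integral>\<^sup>+x. h (f x) \<partial>lborel) \<le> (\<integral>\<^sup>+y. h y \<partial>lborel)"
proof -
  let ?P = "\<lambda>f. \<forall>h\<in>borel_measurable borel.
    ennreal \<bar>det (matrix f)\<bar> * (\<integral>\<^sup>+x. h (f x) \<partial>lborel) \<le> (\<integral>\<^sup>+y. h y \<partial>lborel)"
  have "?P f"
  proof (rule induct_linear_elementary[OF \<open>linear f\<close>]; intro ballI)
    fix f g :: "real ^ 'n \<Rightarrow> real ^ 'n" and h :: "real ^ 'n \<Rightarrow> ennreal"
    assume f: "linear f" "?P f" and g: "linear g" "?P g" and h: "h \<in> borel_measurable borel"
    have hf: "(\<lambda>x. h (f x)) \<in> borel_measurable borel"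
      using h borel_measurable_linear[OF f(1)] by simp
    have "ennreal \<bar>det (matrix (f \<circ> g))\<bar> * (\<integral>\<^sup>+x. h ((f \<circ> g) x) \<partial>lborel)
        = ennreal \<bar>det (matrix f)\<bar> * (ennreal \<bar>det (matrix g)\<bar> * (\<integral>\<^sup>+x. h (f (g x)) \<partial>lborel))"
      using f(1) g(1) by (simp add: matrix_compose det_mul abs_mult ennreal_mult mult.assoc)
    also have "\<dots> \<le> ennreal \<bar>det (matrix f)\<bar> * (\<integral>\<^sup>+x. h (f x) \<partial>lborel)"
      using g(2) hf by (intro mult_left_mono) auto
    also have "\<dots> \<le> (\<integral>\<^sup>+y. h y \<partial>lborel)"
      using f(2) h by auto
    finally show "ennreal \<bar>det (matrix (f \<circ> g))\<bar> * (\<integral>\<^sup>+x. h ((f \<circ> g) x) \<partial>lborel) \<le> (\<integral>\<^sup>+y. h y \<partial>lborel)" .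
  next
    fix f :: "real ^ 'n \<Rightarrow> real ^ 'n" and i and h :: "real ^ 'n \<Rightarrow> ennreal"
    assume "linear f" and "\<And>x. f x $ i = 0"
    then have "\<not> inj f"
      by (metis linear_injective_imp_surjective one_neq_zero surjE vec_component)
    then have "det (matrix f) = 0"
      using det_nz_iff_inj[OF \<open>linear f\<close>] by blast
    then show "ennreal \<bar>det (matrix f)\<bar> * (\<integral>\<^sup>+x. h (f x) \<partial>lborel) \<le> (\<integral>\<^sup>+y. h y \<partial>lborel)"
      by simp
  next
    fix c :: "'n \<Rightarrow> real" and h :: "real ^ 'n \<Rightarrow> ennreal"
    assume h: "h \<in> borel_measurable borel"
    let ?f = "\<lambda>x::real^'n. \<chi> i. c i * x $ i"
    have det: "det (matrix ?f) = prod c UNIV"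
      by (subst det_diagonal) (auto simp: matrix_def axis_def)
    show "ennreal \<bar>det (matrix ?f)\<bar> * (\<integral>\<^sup>+x. h (?f x) \<partial>lborel) \<le> (\<integral>\<^sup>+y. h y \<partial>lborel)"
    proof (cases "\<forall>i. c i \<noteq> 0")
      case False
      then have z: "prod c UNIV = 0" by simp
      show ?thesis unfolding det z by simp
    next
      case True
      let ?c = "\<lambda>b::real^'n. c (axis_index b)"
      have f_eq: "0 + (\<Sum>j\<in>Basis. (?c j * (x \<bullet> j)) *\<^sub>R j) = ?f x" for x
      proof (rule euclidean_eqI)
        fix b :: "real ^ 'n" assume b: "b \<in> Basis"
        then obtain k where k: "b = axis k 1"
          by (auto simp: Basis_vec_def)
        have 2: "?f x \<bullet> b = ?c b * (x \<bullet> b)"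
          by (simp add: k inner_axis axis_index_axis)
        have 3: "(0 + (\<Sum>j\<in>Basis. (?c j * (x \<bullet> j)) *\<^sub>R j)) \<bullet> b = ?c b * (x \<bullet> b)"
          using b by (simp only: add_0_left inner_sum_left_Basis)
        show "(0 + (\<Sum>j\<in>Basis. (?c j * (x \<bullet> j)) *\<^sub>R j)) \<bullet> b = ?f x \<bullet> b"
          by (rule trans[OF 3 sym[OF 2]])
      qed
      have meas: "?f \<in> borel_measurable borel"
        by (intro borel_measurable_vec_lambda borel_measurable_times borel_measurable_vec_nth) simp
      have lb: "(lborel :: (real^'n) measure) = density (distr lborel borel ?f) (\<lambda>_. ennreal \<bar>prod c UNIV\<bar>)"
      proof -
        have c0: "?c j \<noteq> 0" for j using True by simp
        have 1: "(\<Prod>j\<in>Basis. \<bar>?c j\<bar>) = \<bar>prod c UNIV\<bar>"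
          by (simp add: prod_Basis_cart axis_index_axis abs_prod)
        show ?thesis
          using lborel_affine_euclidean[of ?c "0 :: real^'n", OF c0] unfolding f_eq 1 .
      qed
      have "(\<integral>\<^sup>+y. h y \<partial>lborel) = ennreal \<bar>prod c UNIV\<bar> * (\<integral>\<^sup>+x. h (?f x) \<partial>lborel)"
        using h meas
        by (subst lb) (simp add: nn_integral_density nn_integral_distr nn_integral_cmult)
      then show ?thesis using det by simp
    qed
  next
    fix k l :: 'n and h :: "real ^ 'n \<Rightarrow> ennreal"
    assume h: "h \<in> borel_measurable borel"
    let ?f = "\<lambda>v::real^'n. \<chi> i. v $ Transposition.transpose k l i"
    have lin: "linear ?f"
      by (rule linearI) (simp_all add: vec_eq_iff)
    have "norm (?f x) = norm x" for x
      unfolding norm_vec_def L2_set_def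
      by (simp add: sum.reindex_bij_betw[OF bij_transpose, of "\<lambda>i. (x $ i)\<^sup>2"])
    then have int: "(\<integral>\<^sup>+x. h (?f x) \<partial>lborel) = (\<integral>\<^sup>+y. h y \<partial>lborel)"
      using lin h by (intro nn_integral_isometry) auto
    have "matrix ?f = (\<chi> i j. mat 1 $ i $ Transposition.transpose k l j)"
    proof -
      have iff: "Transposition.transpose k l i = j \<longleftrightarrow> i = Transposition.transpose k l j" for i j :: 'n
        by (metis transpose_involutory)
      show ?thesis
        unfolding matrix_def mat_def axis_def by (simp only: vec_eq_iff vec_lambda_beta iff) simp
    qed
    then have "\<bar>det (matrix ?f)\<bar> = 1"
      by (simp add: det_permute_columns permutes_swap_id sign_swap_id abs_mult)
    then show "ennreal \<bar>det (matrix ?f)\<bar> * (\<integral>\<^sup>+x. h (?f x) \<partial>lborel) \<le> (\<integral>\<^sup>+y. h y \<partial>lborel)"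
      using int by simp
  next
    fix k l :: 'n and h :: "real ^ 'n \<Rightarrow> ennreal"
    assume kl: "k \<noteq> l" and h: "h \<in> borel_measurable borel"
    let ?f = "\<lambda>v::real^'n. \<chi> i. if i = k then v $ k + v $ l else v $ i"
    have meas: "?f \<in> borel_measurable borel"
      by (intro borel_measurable_vec_lambda, rename_tac i, case_tac "i = k")
         (auto intro!: borel_measurable_add borel_measurable_vec_nth)
    have "matrix ?f = (\<chi> i. if i = k then row k (mat 1) + 1 *s row l (mat 1) else row i (mat 1))"
      by (auto simp: matrix_def mat_def axis_def vec_eq_iff row_def)
    then have det: "det (matrix ?f) = 1"
      using det_row_operation[OF kl, of "mat 1 :: real^'n^'n" 1] by simp
    have shift: "(\<integral>\<^sup>+t. h (?f (\<chi> i. (s(k := t)) i)) \<partial>lborel) = (\<integral>\<^sup>+t. h (\<chi> i. (s(k := t)) i) \<partial>lborel)" for s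
    proof -
      have m: "(\<lambda>t. h (\<chi> i. (s(k := t)) i)) \<in> borel_measurable borel"
        by (intro measurable_compose[OF _ h] borel_measurable_vec_lambda, rename_tac i, case_tac "i = k") auto
      have "(\<integral>\<^sup>+t. h (\<chi> i. (s(k := t)) i) \<partial>lborel) = (\<integral>\<^sup>+t. h (\<chi> i. (s(k := s l + 1 * t)) i) \<partial>lborel)"
        using nn_integral_real_affine[OF m, of 1 "s l"] by simp
      also have "\<dots> = (\<integral>\<^sup>+t. h (?f (\<chi> i. (s(k := t)) i)) \<partial>lborel)"
        using kl by (intro nn_integral_cong arg_cong[of _ _ h]) (auto simp: vec_eq_iff add.commute)
      finally show ?thesis by simp
    qed
    have "(\<lambda>x. h (?f x)) \<in> borel_measurable borel"
      using measurable_compose[OF meas h] .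
    then have "(\<integral>\<^sup>+x. h (?f x) \<partial>lborel) = (\<integral>\<^sup>+y. h y \<partial>lborel)"
      using h by (simp only: nn_integral_cart_split[of _ k] shift)
    then show "ennreal \<bar>det (matrix ?f)\<bar> * (\<integral>\<^sup>+x. h (?f x) \<partial>lborel) \<le> (\<integral>\<^sup>+y. h y \<partial>lborel)"
      using det by simp
  qed
  then show ?thesis using assms(2) by blast
qed

lemma nn_integral_matrix:
  fixes A :: "real ^ 'n ^ 'n"
  assumes "det A \<noteq> 0" and h: "h \<in> borel_measurable borel"
  shows "ennreal \<bar>det A\<bar> * (\<integral>\<^sup>+x. h (A *v x) \<partial>lborel) = (\<integral>\<^sup>+y. h y \<partial>lborel)"
proof (rule antisym)
  show "ennreal \<bar>det A\<bar> * (\<integral>\<^sup>+x. h (A *v x) \<partial>lborel) \<le> (\<integral>\<^sup>+y. h y \<partial>lborel)"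
    using nn_integral_linear_le[of "(*v) A" h] h by simp
  obtain B where B: "A ** B = mat 1" "B ** A = mat 1"
    using assms(1) by (metis invertible_det_nz invertible_def)
  have det: "det A * det B = 1"
    by (metis B(1) det_I det_mul)
  have hA: "(\<lambda>x. h (A *v x)) \<in> borel_measurable borel"
    using h borel_measurable_linear[of "(*v) A"] by simp
  have "ennreal \<bar>det B\<bar> * (\<integral>\<^sup>+x. h (A *v (B *v x)) \<partial>lborel) \<le> (\<integral>\<^sup>+y. h (A *v y) \<partial>lborel)"
    using nn_integral_linear_le[of "(*v) B" "\<lambda>x. h (A *v x)"] hA by simp
  then have "ennreal \<bar>det B\<bar> * (\<integral>\<^sup>+x. h x \<partial>lborel) \<le> (\<integral>\<^sup>+y. h (A *v y) \<partial>lborel)"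
    by (simp add: matrix_vector_mul_assoc B)
  then have "ennreal \<bar>det A\<bar> * (ennreal \<bar>det B\<bar> * (\<integral>\<^sup>+x. h x \<partial>lborel)) \<le> ennreal \<bar>det A\<bar> * (\<integral>\<^sup>+y. h (A *v y) \<partial>lborel)"
    by (intro mult_left_mono) auto
  moreover have "ennreal \<bar>det A\<bar> * ennreal \<bar>det B\<bar> = 1"
    using det by (simp add: ennreal_mult[symmetric] abs_mult[symmetric])
  ultimately show "(\<integral>\<^sup>+y. h y \<partial>lborel) \<le> ennreal \<bar>det A\<bar> * (\<integral>\<^sup>+x. h (A *v x) \<partial>lborel)"
    by (simp add: mult.assoc[symmetric])
qed

section \<open>Roots and Hoelder's inequality\<close>

text \<open>
Exponents \<open>1 / n\<close> are handled by taking \<open>n\<close>-th powers, which keeps all later arguments in the ordered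
semiring of extended nonnegative reals.
\<close>

lemma ennreal_powr_root_power:
  assumes "n > 0"
  shows "ennreal_powr x (1 / real n) ^ n = x"
proof (cases x)
  case (real r)
  have "(r powr (1 / real n)) ^ n = r"
    using assms real(1) by (cases "r = 0") (simp_all add: powr_power)
  then show ?thesis
    using real by (simp add: ennreal_powr_def ennreal_power)
qed (use assms in \<open>simp add: ennreal_powr_def\<close>)

lemma power_le_imp_le_ennreal:
  fixes x y :: ennreal
  assumes "x ^ n \<le> y ^ n" "n > 0"
  shows "x \<le> y"
proof (cases y)
  case (real s)
  then have "x ^ n < top"
    using assms by (metis ennreal_less_top le_less_trans power_less_top_ennreal)
  then have "x < top"
    using assms(2) by (simp add: power_less_top_ennreal)
  then obtain r where r: "x = ennreal r" "r \<ge> 0"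
    by (cases x) auto
  then have "r ^ n \<le> s ^ n"
    using assms(1) real by (simp add: ennreal_power)
  then have "r \<le> s"
    using real assms(2) by (simp add: power_mono_iff r)
  then show ?thesis
    using real r by (simp add: ennreal_leI)
qed simp

lemma borel_measurable_ennreal_powr [measurable]:
  assumes [measurable]: "f \<in> borel_measurable M"
  shows "(\<lambda>x. ennreal_powr (f x) p) \<in> borel_measurable M"
  unfolding ennreal_powr_def by measurable

text \<open>
The inequality between the means of \<open>k\<close> copies of \<open>u\<close> and one copy of \<open>v\<close>, cleared of denominators.
\<close>

lemma am_gm_ennreal:
  fixes u v :: ennreal
  shows "of_nat (Suc k) ^ Suc k * (u ^ k * v) \<le> (of_nat k * u + v) ^ Suc k"
proof (cases "of_nat k * u + v = top")
  case True
  then show ?thesis by (simp only: top_power_ennreal) simp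
next
  case False
  show ?thesis
  proof (cases "k = 0")
    case True
    then show ?thesis by simp
  next
    case k: False
    with False have "u \<noteq> top" "v \<noteq> top"
      by (auto simp: ennreal_mult_top)
    then obtain a b where ab: "u = ennreal a" "a \<ge> 0" "v = ennreal b" "b \<ge> 0"
      by (metis ennreal_cases)
    define x where "x i = (if i = 0 then b else a)" for i :: nat
    have x: "x i \<ge> 0" for i using ab by (simp add: x_def)
    have prod: "(\<Prod>i\<in>{..k}. x i) = b * a ^ k"
      unfolding x_def by (subst prod.atMost_shift) (simp add: prod_constant)
    have sum: "(\<Sum>i\<in>{..k}. x i / real (card {..k})) = (real k * a + b) / real (Suc k)"
      unfolding x_def sum_divide_distrib[symmetric] by (subst sum.atMost_shift) (simp add: add.commute)
    have le: "(b * a ^ k) powr (1 / real (Suc k)) \<le> (real k * a + b) / real (Suc k)"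
      using arith_geom_mean[of "{..k}" x] x unfolding prod sum by simp
    have "b * a ^ k = ((b * a ^ k) powr (1 / real (Suc k))) ^ Suc k"
    proof (cases "b * a ^ k = 0")
      case True
      show ?thesis unfolding True by simp
    next
      case False
      then show ?thesis using ab by (simp add: powr_power del: power_Suc)
    qed
    also have "\<dots> \<le> ((real k * a + b) / real (Suc k)) ^ Suc k"
      by (intro power_mono le) simp
    finally have "real (Suc k) ^ Suc k * (a ^ k * b) \<le> (real k * a + b) ^ Suc k"
      by (simp add: power_divide field_simps del: power_Suc of_nat_Suc)
    then show ?thesis
      using ab by (simp add: ennreal_of_nat_eq_real_of_nat ennreal_power ennreal_mult'[symmetric]
          ennreal_plus[symmetric] ennreal_leI del: power_Suc of_nat_Suc ennreal_plus)
  qed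
qed

text \<open>
Hoelder's inequality for the exponents \<open>k / (k + 1)\<close> and \<open>1 / (k + 1)\<close>, in a form without fractional
powers: \<open>w\<close> plays the role of \<open>u\<^sup>k\<^sup>/\<^sup>(\<^sup>k\<^sup>+\<^sup>1\<^sup>) v\<^sup>1\<^sup>/\<^sup>(\<^sup>k\<^sup>+\<^sup>1\<^sup>)\<close>. After normalising \<open>\<integral>u\<close> and \<open>\<integral>v\<close> it
is the pointwise mean inequality, integrated.
\<close>

lemma hoelder_power:
  fixes u v w :: "'a \<Rightarrow> ennreal"
  assumes [measurable]: "u \<in> borel_measurable M" "v \<in> borel_measurable M" "w \<in> borel_measurable M"
    and le: "AE x in M. w x ^ Suc k \<le> u x ^ k * v x" and k: "k > 0"
  shows "(\<integral>\<^sup>+x. w x \<partial>M) ^ Suc k \<le> (\<integral>\<^sup>+x. u x \<partial>M) ^ k * (\<integral>\<^sup>+x. v x \<partial>M)"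
proof -
  let ?U = "\<integral>\<^sup>+x. u x \<partial>M" and ?V = "\<integral>\<^sup>+x. v x \<partial>M"
  consider "?U = 0 \<or> ?V = 0" | "?U \<noteq> 0" "?V \<noteq> 0" "?U = top \<or> ?V = top"
    | "?U \<noteq> 0" "?V \<noteq> 0" "?U \<noteq> top" "?V \<noteq> top" by blast
  then show ?thesis
  proof cases
    case 1
    then have "(AE x in M. u x = 0) \<or> (AE x in M. v x = 0)"
      by (simp add: nn_integral_0_iff_AE)
    then have "AE x in M. w x = 0"
    proof
      assume "AE x in M. u x = 0"
      with le show ?thesis by eventually_elim (use k in \<open>auto simp: power_0_left\<close>)
    next
      assume "AE x in M. v x = 0"
      with le show ?thesis by eventually_elim auto
    qed
    then have "(\<integral>\<^sup>+x. w x \<partial>M) = 0"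
      by (simp add: nn_integral_0_iff_AE)
    then show ?thesis by simp
  next
    case 2
    then have "?U ^ k * ?V = top"
      using k by (auto simp: ennreal_mult_eq_top_iff top_power_ennreal)
    then show ?thesis by simp
  next
    case 3
    define t where "t = ennreal_powr (?U ^ k * ?V) (1 / real (Suc k))"
    have t: "t ^ Suc k = ?U ^ k * ?V"
      unfolding t_def by (rule ennreal_powr_root_power) simp
    let ?c = "of_nat (Suc k) :: ennreal"
    let ?m = "\<lambda>x. of_nat k * (u x / ?U) + v x / ?V"
    have pt: "?c * w x \<le> t * ?m x" if "w x ^ Suc k \<le> u x ^ k * v x" for x
    proof (rule power_le_imp_le_ennreal)
      have u: "u x = ?U * (u x / ?U)" and v: "v x = ?V * (v x / ?V)"
        using 3 by (simp_all add: ennreal_times_divide mult_divide_eq_ennreal mult.commute[of "nn_integral M u"] mult.commute[of "nn_integral M v"])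
      have "(?c * w x) ^ Suc k \<le> ?c ^ Suc k * (u x ^ k * v x)"
        using that by (simp add: power_mult_distrib mult_left_mono del: power_Suc of_nat_Suc)
      also have "\<dots> = t ^ Suc k * (?c ^ Suc k * ((u x / ?U) ^ k * (v x / ?V)))"
        unfolding t by (subst u, subst v) (simp add: power_mult_distrib mult_ac del: power_Suc of_nat_Suc)
      also have "\<dots> \<le> t ^ Suc k * (?m x) ^ Suc k"
        by (intro mult_left_mono am_gm_ennreal) simp
      finally show "(?c * w x) ^ Suc k \<le> (t * ?m x) ^ Suc k"
        by (simp only: power_mult_distrib)
    qed simp
    have "?c * (\<integral>\<^sup>+x. w x \<partial>M) = (\<integral>\<^sup>+x. ?c * w x \<partial>M)"
      by (simp add: nn_integral_cmult)
    also have "\<dots> \<le> (\<integral>\<^sup>+x. t * ?m x \<partial>M)"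
    proof (rule nn_integral_mono_AE)
      show "AE x in M. ?c * w x \<le> t * ?m x"
        using le by eventually_elim (rule pt)
    qed
    also have "\<dots> = t * (of_nat k * (?U / ?U) + ?V / ?V)"
      by (simp add: nn_integral_cmult nn_integral_add nn_integral_divide)
    also have "\<dots> = ?c * t"
      using 3 by (simp add: ennreal_divide_self less_top[symmetric] mult.commute add.commute)
    finally have "?c * (\<integral>\<^sup>+x. w x \<partial>M) \<le> ?c * t" .
    then have "(\<integral>\<^sup>+x. w x \<partial>M) \<le> t"
      by (subst (asm) ennreal_mult_le_mult_iff) (simp_all del: of_nat_Suc)
    then have "(\<integral>\<^sup>+x. w x \<partial>M) ^ Suc k \<le> t ^ Suc k"
      by (intro power_mono) simp_all
    then show ?thesis using t by simp
  qed
qed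

section \<open>Integration along fibres and walks\<close>

text \<open>
What the lower bound needs to know about integration along fibres. The map \<open>p i\<close> sends a point to its
fibre, \<open>F i h y\<close> is the integral of \<open>h\<close> over the fibre \<open>y\<close>, and Fubini's theorem
\<open>\<integral> a (p i x) h x = \<integral> a y (F i h y)\<close> is required only up to a factor \<open>c\<close> in both directions. The
factor absorbs the Jacobians of nonlinear fibrations, so that no densities have to be carried along.
\<close>

locale fibre_system =
  fixes M :: "'a measure" and N :: "'b measure"
    and p :: "'i \<Rightarrow> 'a \<Rightarrow> 'b" and F :: "'i \<Rightarrow> ('a \<Rightarrow> ennreal) \<Rightarrow> 'b \<Rightarrow> ennreal"
    and c :: ennreal
  assumes measurable_p [measurable]: "p i \<in> measurable M N"
    and measurable_F: "h \<in> borel_measurable M \<Longrightarrow> F i h \<in> borel_measurable N"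
    and le_fibre: "a \<in> borel_measurable N \<Longrightarrow> h \<in> borel_measurable M \<Longrightarrow>
      (\<integral>\<^sup>+x. a (p i x) * h x \<partial>M) \<le> c * (\<integral>\<^sup>+y. a y * F i h y \<partial>N)"
    and fibre_le: "a \<in> borel_measurable N \<Longrightarrow> h \<in> borel_measurable M \<Longrightarrow>
      (\<integral>\<^sup>+y. a y * F i h y \<partial>N) \<le> c * (\<integral>\<^sup>+x. a (p i x) * h x \<partial>M)"
    and F_bounded: "C < top \<Longrightarrow> (\<And>x. h x \<le> C) \<Longrightarrow> \<exists>C'<top. \<forall>y. F i h y \<le> C'"
begin

text \<open>
\<open>walk is B x\<close> integrates \<open>B\<close> over the end points of all walks that start in \<open>x\<close> and follow fibres
of the families listed in \<open>is\<close>, in this order.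
\<close>

definition walk :: "'i list \<Rightarrow> ('a \<Rightarrow> ennreal) \<Rightarrow> 'a \<Rightarrow> ennreal" where
  "walk is B = foldr (\<lambda>i h x. F i h (p i x)) is B"

lemma walk_simps [simp]:
  "walk [] B = B" "walk (i # is) B x = F i (walk is B) (p i x)"
  by (simp_all add: walk_def)

lemma measurable_walk [measurable]:
  assumes "B \<in> borel_measurable M"
  shows "walk is B \<in> borel_measurable M"
proof (induction "is")
  case Nil
  then show ?case using assms by simp
next
  case (Cons i "is")
  have "(\<lambda>x. F i (walk is B) (p i x)) \<in> borel_measurable M"
    using measurable_F[OF Cons] by measurable
  then show ?case
    by (simp add: walk_def)
qed

lemma measurable_prod_list_fibre:
  assumes "\<And>i. f i \<in> borel_measurable N"
  shows "(\<lambda>x. \<Prod>i\<leftarrow>is. f i (p i x) :: ennreal) \<in> borel_measurable M"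
  using assms by (induction "is") simp_all

text \<open>
A step along family \<open>i\<close> may be moved from \<open>B\<close> to \<open>A\<close>, since \<open>h \<mapsto> F i h \<circ> p i\<close> is self-adjoint up to
\<open>c\<^sup>2\<close>. With \<open>a = F i A \<circ> p i\<close> in place of \<open>A\<close> one step less remains, and the integrand for \<open>A\<close> is
recovered from the one for \<open>a\<close> by Hoelder's inequality with the extra factor \<open>v = f i (p i x) A / a\<close>.
Dividing \<open>A\<close> by its own fibre integral makes the integral of \<open>v\<close> at most \<open>c \<integral> f i\<close>. Boundedness of
\<open>A\<close> keeps \<open>a\<close> finite, so that the division is legitimate wherever \<open>a \<noteq> 0\<close>.
\<close>

lemma integral_power_le_walk:
  assumes A: "A \<in> borel_measurable M" "C < top" "\<And>x. A x \<le> C"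
    and B: "B \<in> borel_measurable M" and f: "\<And>i. f i \<in> borel_measurable N"
    and w: "w \<in> borel_measurable M"
    and le: "\<And>x. w x ^ Suc (length is) \<le> A x * B x * (\<Prod>i\<leftarrow>is. f i (p i x))"
  shows "(\<integral>\<^sup>+x. w x \<partial>M) ^ Suc (length is) \<le>
    c ^ (3 * length is) * (\<Prod>i\<leftarrow>is. \<integral>\<^sup>+y. f i y \<partial>N) * (\<integral>\<^sup>+x. A x * walk is B x \<partial>M)"
  using A w le
proof (induction "is" arbitrary: A C w)
  case Nil
  then show ?case by (auto intro!: nn_integral_mono)
next
  case (Cons i "is")
  note [measurable] = Cons.prems(1) B Cons.prems(4) f measurable_F[OF Cons.prems(1)]
  define k where "k = length is"
  define a where "a x = F i A (p i x)" for x
  define R where "R x = B x * (\<Prod>i\<leftarrow>is. f i (p i x))" for x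
  define u where "u x = ennreal_powr (a x * R x) (1 / real (Suc k))" for x
  define v where "v x = f i (p i x) / a x * A x" for x
  have [measurable]: "a \<in> borel_measurable M"
    unfolding a_def by measurable
  have [measurable]: "R \<in> borel_measurable M"
    unfolding R_def using measurable_prod_list_fibre[of f "is"] f by measurable
  have [measurable]: "u \<in> borel_measurable M" "v \<in> borel_measurable M"
    unfolding u_def v_def by measurable
  obtain C' where C': "C' < top" "\<And>y. F i A y \<le> C'"
    using F_bounded[of C A i] Cons.prems(2,3) by blast
  have a_less: "a x < top" and a_le: "a x \<le> C'" for x
    unfolding a_def using C' by (auto intro: le_less_trans)
  have u_pow: "u x ^ Suc k = a x * R x" for x
    unfolding u_def by (rule ennreal_powr_root_power) simp
  \<comment> \<open>A vanishes almost everywhere on the fibres where its own fibre integral is zero.\<close>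
  have "(\<integral>\<^sup>+x. indicator {y. F i A y = 0} (p i x) * A x \<partial>M)
      \<le> c * (\<integral>\<^sup>+y. indicator {y\<in>space N. F i A y = 0} y * F i A y \<partial>N)"
    using le_fibre[of "indicator {y\<in>space N. F i A y = 0}" A i] measurable_space[OF measurable_p]
    by (auto simp: indicator_def cong: nn_integral_cong_simp)
  also have "(\<integral>\<^sup>+y. indicator {y\<in>space N. F i A y = 0} y * F i A y \<partial>N) = 0"
    by (subst nn_integral_0_iff_AE) (auto split: split_indicator)
  finally have "(\<integral>\<^sup>+x. indicator {x\<in>space M. a x = 0} x * A x \<partial>M) = 0"
    by (simp add: a_def indicator_def cong: nn_integral_cong_simp)
  then have "AE x in M. indicator {x\<in>space M. a x = 0} x * A x = 0"
    by (subst (asm) nn_integral_0_iff_AE) auto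
  then have zero: "AE x in M. a x = 0 \<longrightarrow> A x = 0"
    using AE_space by eventually_elim (auto split: split_indicator_asm)
  have "AE x in M. w x ^ Suc (Suc k) \<le> u x ^ Suc k * v x"
    using zero
  proof eventually_elim
    case (elim x)
    have le: "w x ^ Suc (Suc k) \<le> A x * B x * (f i (p i x) * (\<Prod>i\<leftarrow>is. f i (p i x)))"
      using Cons.prems(5)[of x] by (simp add: k_def)
    show ?case
    proof (cases "a x = 0")
      case True
      then show ?thesis using le elim by auto
    next
      case False
      have "u x ^ Suc k * v x = (f i (p i x) / a x * a x) * (A x * R x)"
        unfolding u_pow v_def by (simp only: mult_ac)
      also have "f i (p i x) / a x * a x = f i (p i x)"
        using False a_less[of x] by (simp add: ennreal_divide_times ennreal_divide_self)
      finally show ?thesis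
        using le by (simp add: R_def mult_ac)
    qed
  qed
  then have "(\<integral>\<^sup>+x. w x \<partial>M) ^ Suc (Suc k) \<le> (\<integral>\<^sup>+x. u x \<partial>M) ^ Suc k * (\<integral>\<^sup>+x. v x \<partial>M)"
    by (intro hoelder_power) simp_all
  also have "\<dots> \<le> (c ^ (3 * k) * (\<Prod>i\<leftarrow>is. \<integral>\<^sup>+y. f i y \<partial>N) * (c * (c * (\<integral>\<^sup>+x. A x * walk (i # is) B x \<partial>M)))) *
      (c * (\<integral>\<^sup>+y. f i y \<partial>N))"
  proof (rule mult_mono)
    have "(\<integral>\<^sup>+x. u x \<partial>M) ^ Suc k \<le> c ^ (3 * k) * (\<Prod>i\<leftarrow>is. \<integral>\<^sup>+y. f i y \<partial>N) * (\<integral>\<^sup>+x. a x * walk is B x \<partial>M)"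
      unfolding k_def using u_pow a_le C'(1)
      by (intro Cons.IH[where C = C']) (simp_all add: R_def k_def mult.assoc)
    also have "(\<integral>\<^sup>+x. a x * walk is B x \<partial>M) \<le> c * (c * (\<integral>\<^sup>+x. A x * walk (i # is) B x \<partial>M))"
    proof -
      have mw: "walk is B \<in> borel_measurable M" "F i (walk is B) \<in> borel_measurable N"
        using B by (auto intro: measurable_walk measurable_F)
      have "(\<integral>\<^sup>+x. a x * walk is B x \<partial>M) \<le> c * (\<integral>\<^sup>+y. F i A y * F i (walk is B) y \<partial>N)"
        unfolding a_def using mw by (intro le_fibre) auto
      also have "(\<integral>\<^sup>+y. F i A y * F i (walk is B) y \<partial>N) = (\<integral>\<^sup>+y. F i (walk is B) y * F i A y \<partial>N)"
        by (simp add: mult.commute)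
      also have "\<dots> \<le> c * (\<integral>\<^sup>+x. F i (walk is B) (p i x) * A x \<partial>M)"
        using mw by (intro fibre_le) auto
      finally have "(\<integral>\<^sup>+x. a x * walk is B x \<partial>M)
          \<le> c * (c * (\<integral>\<^sup>+x. F i (walk is B) (p i x) * A x \<partial>M))"
        by (simp add: mult_left_mono)
      then show ?thesis
        by (simp add: mult.commute)
    qed
    finally show "(\<integral>\<^sup>+x. u x \<partial>M) ^ Suc k \<le> c ^ (3 * k) * (\<Prod>i\<leftarrow>is. \<integral>\<^sup>+y. f i y \<partial>N) *
        (c * (c * (\<integral>\<^sup>+x. A x * walk (i # is) B x \<partial>M)))"
      by (simp add: mult_left_mono)
    have "(\<integral>\<^sup>+x. v x \<partial>M) \<le> c * (\<integral>\<^sup>+y. f i y / F i A y * F i A y \<partial>N)"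
      unfolding v_def a_def by (intro le_fibre[where a = "\<lambda>y. f i y / F i A y"]) auto
    also have "\<dots> \<le> c * (\<integral>\<^sup>+y. f i y \<partial>N)"
    proof (intro mult_left_mono nn_integral_mono)
      fix y
      show "f i y / F i A y * F i A y \<le> f i y"
        using le_less_trans[OF C'(2) C'(1), of y]
        by (cases "F i A y = 0") (simp_all add: ennreal_divide_times ennreal_divide_self)
    qed simp
    finally show "(\<integral>\<^sup>+x. v x \<partial>M) \<le> c * (\<integral>\<^sup>+y. f i y \<partial>N)" .
  qed simp_all
  also have "\<dots> = c ^ (3 * Suc k) * (\<Prod>i\<leftarrow>i # is. \<integral>\<^sup>+y. f i y \<partial>N) * (\<integral>\<^sup>+x. A x * walk (i # is) B x \<partial>M)"
    by (simp add: power_add numeral_3_eq_3 mult_ac)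
  finally show ?case
    by (simp add: k_def)
qed

end

section \<open>One near-linear submersion\<close>

text \<open>
The square matrix whose determinants define \<^const>\<open>wedge_rows\<close>, with a general first row \<open>v\<close> in place
of a basis vector.
\<close>

definition stack :: "real ^ 'n ^ 'm::finite \<Rightarrow> real ^ 'n \<Rightarrow> real ^ 'n ^ 'n" where
  "stack A v = (\<chi> i. case inv (row_enum :: 'm option \<Rightarrow> 'n) i of None \<Rightarrow> v | Some a \<Rightarrow> A $ a)"

text \<open>
The isometric identification of \<open>\<real>\<^sup>m \<times> \<real>\<close> with \<open>\<real>\<^sup>n\<close> that uses the same enumeration of coordinates
as \<^const>\<open>stack\<close>, so that \<open>join (A x, v \<bullet> x)\<close> is the image of \<open>x\<close> under the stacked matrix.
\<close>

definition join :: "(real ^ 'm::finite) \<times> real \<Rightarrow> real ^ 'n" where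
  "join z = (\<chi> i. case inv (row_enum :: 'm option \<Rightarrow> 'n) i of None \<Rightarrow> snd z | Some a \<Rightarrow> fst z $ a)"

lemma bij_row_enum:
  assumes "CARD('n::finite) = Suc CARD('m::finite)"
  shows "bij (row_enum :: 'm option \<Rightarrow> 'n)"
proof -
  have "card (UNIV :: 'm option set) = card (UNIV :: 'n set)"
    using assms by (simp add: card_UNIV_option)
  then obtain e :: "'m option \<Rightarrow> 'n" where "bij_betw e UNIV UNIV"
    using finite_same_card_bij[of "UNIV :: 'm option set" "UNIV :: 'n set"] by auto
  then show ?thesis
    unfolding row_enum_def by (rule someI[of bij])
qed

lemma wedge_rows_nth: "wedge_rows A $ k = det (stack A (axis k 1))"
  by (simp add: wedge_rows_def stack_def)

context
  fixes A :: "real ^ 'n ^ 'm::finite"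
  assumes card: "CARD('n) = Suc CARD('m)"
begin

lemma inv_row_enum: "inv (row_enum :: 'm option \<Rightarrow> 'n) (row_enum j) = j"
  using bij_row_enum[OF card] by (simp add: bij_is_inj)

lemma stack_row [simp]:
  "stack A v $ row_enum (None :: 'm option) = v" "stack A v $ row_enum (Some a) = A $ a"
  by (simp_all add: stack_def inv_row_enum)

lemma stack_eq: "stack A v = (\<chi> i. if i = row_enum (None :: 'm option) then v else stack A 0 $ i)"
proof -
  have "inv (row_enum :: 'm option \<Rightarrow> 'n) i = None \<longleftrightarrow> i = row_enum (None :: 'm option)" for i :: 'n
    using bij_row_enum[OF card] by (metis bij_inv_eq_iff)
  then show ?thesis
    by (auto simp: stack_def vec_eq_iff inv_row_enum split: option.splits)
qed

text \<open>
Both sides are linear in \<open>v\<close> and agree on the standard basis.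
\<close>

lemma det_stack: "det (stack A v) = v \<bullet> wedge_rows A"
proof -
  let ?r = "row_enum (None :: 'm option) :: 'n"
  let ?c = "\<lambda>i. stack A 0 $ i"
  have "det (stack A v) = det (\<chi> i. if i = ?r then (\<Sum>k\<in>UNIV. v $ k *s axis k 1) else ?c i)"
    unfolding basis_expansion by (rule arg_cong[OF stack_eq])
  also have "\<dots> = (\<Sum>k\<in>UNIV. det (\<chi> i. if i = ?r then v $ k *s axis k 1 else ?c i))"
    by (rule det_linear_row_sum) simp
  also have "\<dots> = (\<Sum>k\<in>UNIV. v $ k * det (\<chi> i. if i = ?r then axis k 1 else ?c i))"
    by (simp add: det_row_mul)
  also have "\<dots> = (\<Sum>k\<in>UNIV. v $ k * wedge_rows A $ k)"
    by (simp add: wedge_rows_nth stack_eq[symmetric])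
  finally show ?thesis
    by (simp add: inner_vec_def)
qed

lemma wedge_rows_kernel: "A *v wedge_rows A = 0"
proof -
  have "(A *v wedge_rows A) $ a = 0" for a
  proof -
    have "(A *v wedge_rows A) $ a = det (stack A (A $ a))"
      by (simp add: det_stack matrix_vector_mult_def inner_vec_def)
    also have "\<dots> = 0"
    proof (rule det_identical_rows)
      show "(row_enum (None :: 'm option) :: 'n) \<noteq> row_enum (Some a)"
        by (metis inv_row_enum option.distinct(1))
      show "row (row_enum (None :: 'm option)) (stack A (A $ a)) = row (row_enum (Some a)) (stack A (A $ a))"
        by (simp add: row_def)
    qed
    finally show ?thesis .
  qed
  then show ?thesis by (simp add: vec_eq_iff)
qed

lemma join_coords: "join (A *v x, v \<bullet> x) = stack A v *v x"
  by (auto simp: join_def stack_def vec_eq_iff matrix_vector_mult_def inner_vec_def split: option.splits)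

end

lemma linear_join: "linear join"
  by (rule linearI) (auto simp: join_def vec_eq_iff split: option.splits)

lemma norm_join:
  fixes z :: "(real ^ 'm) \<times> real"
  assumes "CARD('n) = Suc CARD('m)"
  shows "norm (join z :: real ^ 'n) = norm z"
proof -
  let ?e = "row_enum :: 'm option \<Rightarrow> 'n"
  have "(\<Sum>i\<in>UNIV. ((join z :: real ^ 'n) $ i)\<^sup>2) = (\<Sum>j\<in>UNIV. ((join z :: real ^ 'n) $ ?e j)\<^sup>2)"
    by (rule sum.reindex_bij_betw[symmetric, OF bij_row_enum[OF assms]])
  also have "\<dots> = (snd z)\<^sup>2 + (\<Sum>a\<in>UNIV. (fst z $ a)\<^sup>2)"
  proof -
    have nth: "(join z :: real ^ 'n) $ ?e j = (case j of None \<Rightarrow> snd z | Some a \<Rightarrow> fst z $ a)" for j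
      by (simp add: join_def inv_row_enum[OF assms])
    show ?thesis
      unfolding nth by (simp add: UNIV_option_conv sum.reindex)
  qed
  finally show ?thesis
    unfolding norm_prod_def by (simp add: norm_vec_def L2_set_def add.commute sum_nonneg)
qed

lemma nn_integral_fibre_coords:
  fixes A :: "real ^ 'n ^ 'm::finite"
  assumes card: "CARD('n) = Suc CARD('m)" and det: "det (stack A v) \<noteq> 0"
    and H: "H \<in> borel_measurable borel"
  shows "ennreal \<bar>det (stack A v)\<bar> * (\<integral>\<^sup>+x. H (A *v x, v \<bullet> x) \<partial>lborel) = (\<integral>\<^sup>+z. H z \<partial>lborel)"
proof -
  let ?j = "join :: (real ^ 'm) \<times> real \<Rightarrow> real ^ 'n"
  have inj: "inj ?j"
    using linear_join norm_join[OF card] by (metis linear_injective_0 norm_eq_zero)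
  obtain k where k: "linear k" "\<And>z. k (?j z) = z"
    using linear_injective_left_inverse[OF linear_join inj] by (auto simp: fun_eq_iff)
  have Hk: "(\<lambda>x. H (k x)) \<in> borel_measurable borel"
    using borel_measurable_linear[OF k(1)] H by simp
  have "(\<integral>\<^sup>+z. H z \<partial>lborel) = (\<integral>\<^sup>+z. H (k (?j z)) \<partial>lborel)"
    by (simp add: k)
  also have "\<dots> = (\<integral>\<^sup>+x. H (k x) \<partial>lborel)"
    using nn_integral_isometry[of ?j "\<lambda>x. H (k x)"] linear_join norm_join[OF card] Hk card by simp
  also have "\<dots> = ennreal \<bar>det (stack A v)\<bar> * (\<integral>\<^sup>+x. H (k (stack A v *v x)) \<partial>lborel)"
    using nn_integral_matrix[OF det Hk] by simp
  finally show ?thesis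
    by (simp add: join_coords[OF card, symmetric] k)
qed

lemma matrix_inv_mult:
  fixes S :: "real ^ 'n ^ 'n"
  assumes "det S \<noteq> 0"
  shows "matrix_inv S ** S = mat 1" "S ** matrix_inv S = mat 1"
  using assms someI_ex[of "\<lambda>B. S ** B = mat 1 \<and> B ** S = mat 1"]
  unfolding matrix_inv_def by (auto simp: invertible_det_nz[symmetric] invertible_def)

text \<open>
The inverse of the linear coordinates \<open>x \<mapsto> (A x, v \<bullet> x)\<close>, for invertible \<open>stack A v\<close>.
\<close>

definition coords_inv :: "real ^ 'n ^ 'm \<Rightarrow> real ^ 'n \<Rightarrow> (real ^ 'm) \<times> real \<Rightarrow> real ^ 'n" where
  "coords_inv A v z = matrix_inv (stack A v) *v join z"

lemma linear_coords_inv: "linear (coords_inv A v)"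
  unfolding coords_inv_def
  using linear_compose[OF linear_join matrix_vector_mul_linear] by (simp add: o_def)

text \<open>
A map \<open>p\<close> whose differences on \<open>V\<close> are close to those of the linear map \<open>A\<close>. The error is
measured after applying the inverse linear coordinates, where closeness to \<open>A\<close> becomes closeness to
the identity and gives Lipschitz constants near \<open>1\<close>. The functional \<open>x \<mapsto> v \<bullet> x\<close> serves as parameter
on the fibres of \<open>p\<close>; the determinant condition is a normalisation of \<open>v\<close>.
\<close>

locale near_linear_fibration =
  fixes V :: "(real ^ 'n) set" and p :: "real ^ 'n \<Rightarrow> real ^ 'm"
    and A :: "real ^ 'n ^ 'm" and v :: "real ^ 'n" and \<eta> :: real
  assumes card: "CARD('n) = Suc CARD('m)" and open_V: "open V" and bounded_V: "bounded V"
    and det: "\<bar>det (stack A v)\<bar> = 1" and \<eta>: "0 \<le> \<eta>" "\<eta> < 1"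
    and p [measurable]: "p \<in> borel_measurable borel"
    and near: "x \<in> V \<Longrightarrow> y \<in> V \<Longrightarrow>
      norm (coords_inv A v (p x - p y - A *v (x - y), 0)) \<le> \<eta> * norm (x - y)"
begin

text \<open>
\<open>\<Phi>\<close> straightens the fibres of \<open>p\<close>, with image \<open>W\<close> and inverse \<open>\<Psi>\<close>; \<open>L\<close> is its linear model, and
\<open>G = L\<^sup>-\<^sup>1 \<circ> \<Phi>\<close> is the near-identity to which the expansion lemma applies. Finally \<open>fib h y\<close> integrates
\<open>h\<close> along the part of the fibre over \<open>y\<close> that lies in \<open>V\<close>; the value of \<open>\<Psi>\<close> off \<open>W\<close> is never seen.
\<close>

definition "L x = (A *v x, v \<bullet> x)"
definition "\<Phi> x = (p x, v \<bullet> x)"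
definition "G x = coords_inv A v (\<Phi> x)"
definition "W = \<Phi> ` V"
definition "\<Psi> z = (if z \<in> W then inv_into V \<Phi> z else 0)"
definition "fib h y = (\<integral>\<^sup>+s. indicator W (y, s) * h (\<Psi> (y, s)) \<partial>lborel)"

lemma linear_L: "linear L"
  unfolding L_def by (intro linearI) (simp_all add: matrix_vector_right_distrib inner_add_right matrix_vector_mult_scaleR)

lemma det_nz: "det (stack A v) \<noteq> 0"
  using det by auto

lemma coords_inv_L: "coords_inv A v (L x) = x"
  unfolding coords_inv_def L_def
  by (simp add: join_coords[OF card] matrix_vector_mul_assoc matrix_inv_mult det_nz)

lemma L_coords_inv: "L (coords_inv A v z) = z"
proof -
  have "(join (L (coords_inv A v z)) :: real ^ 'n) = join z"
    unfolding L_def join_coords[OF card] coords_inv_def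
    by (simp add: matrix_vector_mul_assoc matrix_inv_mult det_nz)
  then have "norm (join (L (coords_inv A v z) - z) :: real ^ 'n) = 0"
    by (simp add: linear_diff[OF linear_join])
  then show ?thesis
    by (simp add: norm_join[OF card])
qed

lemma nn_integral_L:
  assumes "H \<in> borel_measurable borel"
  shows "(\<integral>\<^sup>+x. H (L x) \<partial>lborel) = (\<integral>\<^sup>+z. H z \<partial>lborel)"
  using nn_integral_fibre_coords[OF card _ assms, of A v] det unfolding L_def by force

lemma G_near: "x \<in> V \<Longrightarrow> y \<in> V \<Longrightarrow> norm (G x - G y - (x - y)) \<le> \<eta> * norm (x - y)"
proof -
  assume xy: "x \<in> V" "y \<in> V"
  have "G x - G y - (x - y) = coords_inv A v (\<Phi> x - \<Phi> y - L (x - y))"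
    by (simp only: G_def linear_diff[OF linear_coords_inv] coords_inv_L)
  also have "\<Phi> x - \<Phi> y - L (x - y) = (p x - p y - A *v (x - y), 0)"
    by (simp add: \<Phi>_def L_def inner_diff_right)
  finally show ?thesis using near[OF xy] by simp
qed

lemma G_expanding: "x \<in> V \<Longrightarrow> y \<in> V \<Longrightarrow> norm (x - y) \<le> 1 / (1 - \<eta>) * norm (G x - G y)"
  using G_near[of x y] \<eta> norm_triangle_ineq2[of "x - y" "G x - G y"]
  by (simp add: field_simps norm_minus_commute)

lemma G_lipschitz: "x \<in> V \<Longrightarrow> y \<in> V \<Longrightarrow> norm (G x - G y) \<le> (1 + \<eta>) * norm (x - y)"
  using G_near[of x y] norm_triangle_ineq2[of "G x - G y" "x - y"]
  by (simp add: field_simps)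

lemma inj_G: "inj_on G V"
  using G_expanding by (fastforce intro: inj_onI)

lemma inj_\<Phi>: "inj_on \<Phi> V"
  using inj_G by (auto simp: inj_on_def G_def)

lemma \<Psi>_\<Phi>: "x \<in> V \<Longrightarrow> \<Psi> (\<Phi> x) = x"
  by (simp add: \<Psi>_def W_def inj_\<Phi>)

lemma \<Phi>_\<Psi>: "z \<in> W \<Longrightarrow> \<Phi> (\<Psi> z) = z" and \<Psi>_in: "z \<in> W \<Longrightarrow> \<Psi> z \<in> V"
  by (auto simp: W_def \<Psi>_\<Phi>)

lemma \<Phi>_in: "x \<in> V \<Longrightarrow> \<Phi> x \<in> W"
  by (simp add: W_def)

lemma L_G: "L (G x) = \<Phi> x"
  by (simp add: G_def L_coords_inv)

text \<open>
Invariance of domain; this is needed only to know that \<open>W\<close> is a Borel set.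
\<close>

lemma open_G_image: "open (G ` V)"
proof -
  have "(1 + \<eta>)-lipschitz_on V G"
    using G_lipschitz \<eta> by (intro lipschitz_onI) (simp_all add: dist_norm)
  then show ?thesis
    by (intro invariance_of_domain lipschitz_on_continuous_on open_V inj_G)
qed

lemma W_eq: "W = coords_inv A v -` (G ` V)"
proof (intro set_eqI iffI)
  fix z assume "z \<in> coords_inv A v -` (G ` V)"
  then obtain x where "x \<in> V" "coords_inv A v z = G x" by auto
  then have "z = \<Phi> x" by (metis L_coords_inv L_G)
  then show "z \<in> W" using \<open>x \<in> V\<close> by (simp add: W_def)
qed (auto simp: W_def G_def)

lemma open_W: "open W"
  unfolding W_eq
  by (intro open_vimage open_G_image linear_continuous_on) (simp add: linear_conv_bounded_linear[symmetric] linear_coords_inv)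

lemma W_measurable [measurable]: "W \<in> sets borel"
  using open_W by simp

lemma G_measurable: "G \<in> borel_measurable borel"
  unfolding G_def \<Phi>_def
  by (intro measurable_compose[OF _ borel_measurable_linear[OF linear_coords_inv]] borel_measurable_Pair p) simp

lemma \<Psi>_measurable [measurable]: "\<Psi> \<in> borel_measurable borel"
proof -
  obtain B where B: "\<And>z. norm (coords_inv A v z) \<le> B * norm z" "B > 0"
    using linear_coords_inv[of A v] linear_bounded_pos by blast
  have "(1 / (1 - \<eta>) * B)-lipschitz_on W \<Psi>"
  proof (rule lipschitz_onI)
    fix z z' assume z: "z \<in> W" "z' \<in> W"
    have "norm (\<Psi> z - \<Psi> z') \<le> 1 / (1 - \<eta>) * norm (G (\<Psi> z) - G (\<Psi> z'))"
      using z by (intro G_expanding \<Psi>_in)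
    also have "G (\<Psi> z) - G (\<Psi> z') = coords_inv A v (z - z')"
      using z by (simp add: G_def \<Phi>_\<Psi> linear_diff[OF linear_coords_inv])
    also have "1 / (1 - \<eta>) * norm (coords_inv A v (z - z')) \<le> 1 / (1 - \<eta>) * (B * norm (z - z'))"
      using \<eta> B(1) by (intro mult_left_mono) simp_all
    finally show "dist (\<Psi> z) (\<Psi> z') \<le> 1 / (1 - \<eta>) * B * dist z z'"
      by (simp add: dist_norm)
  qed (use \<eta> B(2) in simp)
  then have "continuous_on W \<Psi>"
    by (rule lipschitz_on_continuous_on)
  then have "continuous_on W (inv_into V \<Phi>)"
    by (subst (asm) continuous_on_cong[OF refl, of _ _ "inv_into V \<Phi>"]) (simp_all add: \<Psi>_def)
  then show ?thesis
    unfolding \<Psi>_def[abs_def] by (intro borel_measurable_continuous_on_if) simp_all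
qed

lemma fib_integrand_measurable:
  fixes h :: "real ^ 'n \<Rightarrow> ennreal"
  assumes "h \<in> borel_measurable borel"
  shows "(\<lambda>z. indicator W z * h (\<Psi> z)) \<in> borel_measurable borel"
  by (intro borel_measurable_times_ennreal borel_measurable_indicator W_measurable
      measurable_compose[OF \<Psi>_measurable assms])

lemma fib_weighted_measurable:
  fixes h :: "real ^ 'n \<Rightarrow> ennreal"
  assumes "a \<in> borel_measurable borel" "h \<in> borel_measurable borel"
  shows "(\<lambda>z. indicator W z * (a (fst z) * h (\<Psi> z))) \<in> borel_measurable borel"
proof -
  have "fst \<in> borel_measurable (borel :: ((real ^ 'm) \<times> real) measure)"
    by (intro borel_measurable_continuous_onI continuous_intros)
  from measurable_compose[OF this assms(1)] show ?thesis
    by (intro borel_measurable_times_ennreal borel_measurable_indicator W_measurable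
        measurable_compose[OF \<Psi>_measurable assms(2)])
qed

lemma fib_measurable:
  assumes "h \<in> borel_measurable borel"
  shows "fib h \<in> borel_measurable borel"
proof -
  have "(\<lambda>z. indicator W z * h (\<Psi> z)) \<in> borel_measurable (lborel \<Otimes>\<^sub>M lborel)"
    using fib_integrand_measurable[OF assms] by (simp add: lborel_prod)
  from lborel.borel_measurable_nn_integral_fst[OF this] show ?thesis
    by (simp add: fib_def[abs_def])
qed

lemma nn_integral_fib:
  assumes a: "a \<in> borel_measurable borel" and h: "h \<in> borel_measurable borel"
  shows "(\<integral>\<^sup>+y. a y * fib h y \<partial>lborel) = (\<integral>\<^sup>+z. indicator W z * (a (fst z) * h (\<Psi> z)) \<partial>lborel)"
proof -
  let ?H = "\<lambda>z. indicator W z * (a (fst z) * h (\<Psi> z))"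
  have H: "?H \<in> borel_measurable (lborel \<Otimes>\<^sub>M lborel)"
    using fib_weighted_measurable[OF a h] by (simp add: lborel_prod)
  have m: "(\<lambda>s. indicator W (y, s) * h (\<Psi> (y, s))) \<in> borel_measurable lborel" for y
    using measurable_compose[OF _ fib_integrand_measurable[OF h], of "\<lambda>s. (y, s)" lborel] by simp
  have "(\<integral>\<^sup>+z. ?H z \<partial>lborel) = (\<integral>\<^sup>+y. \<integral>\<^sup>+s. ?H (y, s) \<partial>lborel \<partial>lborel)"
    using lborel.nn_integral_fst[OF H] by (simp add: lborel_prod)
  also have "\<dots> = (\<integral>\<^sup>+y. a y * fib h y \<partial>lborel)"
    unfolding fib_def using m by (simp add: nn_integral_cmult[symmetric] mult_ac)
  finally show ?thesis ..
qed

text \<open>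
Together with \<open>fib_le\<close> this is Fubini's theorem for the fibration, up to the distortion of \<open>G\<close>: here
\<open>G\<close> expands by at least \<open>1 - \<eta>\<close>, and there its inverse expands by at least \<open>1 / (1 + \<eta>)\<close>.
\<close>

lemma le_fib:
  assumes a: "a \<in> borel_measurable borel" and h: "h \<in> borel_measurable borel"
  shows "(\<integral>\<^sup>+x. indicator V x * (a (p x) * h x) \<partial>lborel)
    \<le> ennreal ((1 / (1 - \<eta>)) ^ CARD('n)) * (\<integral>\<^sup>+y. a y * fib h y \<partial>lborel)"
proof -
  let ?H = "\<lambda>z. indicator W z * (a (fst z) * h (\<Psi> z))"
  have H: "?H \<in> borel_measurable borel"
    by (rule fib_weighted_measurable[OF a h])
  have HL: "(\<lambda>x. ?H (L x)) \<in> borel_measurable borel"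
    using measurable_compose[OF borel_measurable_linear[OF linear_L] H] by simp
  have "(\<integral>\<^sup>+x. indicator V x * (a (p x) * h x) \<partial>lborel) = (\<integral>\<^sup>+x. indicator V x * ?H (L (G x)) \<partial>lborel)"
  proof (intro nn_integral_cong)
    fix x
    show "indicator V x * (a (p x) * h x) = indicator V x * ?H (L (G x))"
      by (cases "x \<in> V") (simp_all add: L_G \<Psi>_\<Phi> \<Phi>_in, simp add: \<Phi>_def)
  qed
  also have "\<dots> \<le> ennreal ((1 / (1 - \<eta>)) ^ DIM(real ^ 'n)) * (\<integral>\<^sup>+x. ?H (L x) \<partial>lborel)"
    using open_V \<eta> G_expanding G_measurable
    by (intro nn_integral_expanding[OF _ _ _ _ _ HL]) simp_all
  also have "(\<integral>\<^sup>+x. ?H (L x) \<partial>lborel) = (\<integral>\<^sup>+y. a y * fib h y \<partial>lborel)"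
    by (simp only: nn_integral_L[OF H] nn_integral_fib[OF a h])
  finally show ?thesis by simp
qed

lemma fib_le:
  assumes a: "a \<in> borel_measurable borel" and h: "h \<in> borel_measurable borel"
  shows "(\<integral>\<^sup>+y. a y * fib h y \<partial>lborel)
    \<le> ennreal ((1 / (1 - \<eta>)) ^ CARD('n)) * (\<integral>\<^sup>+x. indicator V x * (a (p x) * h x) \<partial>lborel)"
proof -
  let ?H = "\<lambda>z. indicator W z * (a (fst z) * h (\<Psi> z))"
  let ?Q = "\<lambda>x. indicator V x * (a (p x) * h x)"
  have [measurable]: "V \<in> sets borel" using open_V by simp
  have H: "?H \<in> borel_measurable borel"
    by (rule fib_weighted_measurable[OF a h])
  note [measurable] = a h
  have Q: "?Q \<in> borel_measurable borel"
    by measurable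
  have "(\<integral>\<^sup>+y. a y * fib h y \<partial>lborel) = (\<integral>\<^sup>+u. ?H (L u) \<partial>lborel)"
    by (simp only: nn_integral_L[OF H] nn_integral_fib[OF a h])
  also have "\<dots> = (\<integral>\<^sup>+u. indicator (G ` V) u * ?Q (\<Psi> (L u)) \<partial>lborel)"
  proof (intro nn_integral_cong)
    fix u
    show "?H (L u) = indicator (G ` V) u * ?Q (\<Psi> (L u))"
    proof (cases "u \<in> G ` V")
      case True
      then obtain x where "x \<in> V" "u = G x" by auto
      then show ?thesis by (simp add: L_G \<Psi>_\<Phi> \<Phi>_in) (simp add: \<Phi>_def)
    next
      case False
      then have "L u \<notin> W" by (simp add: W_eq coords_inv_L)
      then show ?thesis using False by simp
    qed
  qed
  also have "\<dots> \<le> ennreal ((1 + \<eta>) ^ DIM(real ^ 'n)) * (\<integral>\<^sup>+x. ?Q x \<partial>lborel)"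
  proof (rule nn_integral_expanding[OF refl _ _ _ _ Q])
    show "(\<lambda>u. \<Psi> (L u)) \<in> borel_measurable borel"
      using measurable_compose[OF borel_measurable_linear[OF linear_L] \<Psi>_measurable] .
    fix u u' assume "u \<in> G ` V" "u' \<in> G ` V"
    then show "norm (u - u') \<le> (1 + \<eta>) * norm (\<Psi> (L u) - \<Psi> (L u'))"
      using G_lipschitz by (auto simp: L_G \<Psi>_\<Phi>)
  qed (use open_G_image \<eta> in simp_all)
  also have "\<dots> \<le> ennreal ((1 / (1 - \<eta>)) ^ CARD('n)) * (\<integral>\<^sup>+x. ?Q x \<partial>lborel)"
  proof (intro mult_right_mono ennreal_leI)
    have "(1 + \<eta>) * (1 - \<eta>) \<le> 1" by (simp add: algebra_simps)
    then have "1 + \<eta> \<le> 1 / (1 - \<eta>)" using \<eta> by (simp add: field_simps)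
    then show "(1 + \<eta>) ^ DIM(real ^ 'n) \<le> (1 / (1 - \<eta>)) ^ CARD('n)"
      using \<eta> by (simp add: power_mono)
  qed simp
  finally show ?thesis .
qed

lemma fib_bounded:
  assumes "C < top" "\<And>x. h x \<le> C"
  shows "\<exists>C'<top. \<forall>y. fib h y \<le> C'"
proof -
  obtain r where r: "\<And>x. x \<in> V \<Longrightarrow> norm x \<le> r"
    using bounded_V by (auto simp: bounded_iff)
  let ?R = "norm v * \<bar>r\<bar>"
  have W: "s \<in> {- ?R..?R}" if ys: "(y, s) \<in> W" for y s
  proof -
    obtain x where x: "x \<in> V" "s = v \<bullet> x"
      using ys by (auto simp: W_def \<Phi>_def)
    have "\<bar>s\<bar> \<le> norm v * norm x"
      using x by (simp add: Cauchy_Schwarz_ineq2)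
    also have "\<dots> \<le> ?R"
      using r[OF x(1)] by (intro mult_left_mono) auto
    finally show ?thesis by auto
  qed
  have "fib h y \<le> C * emeasure lborel {- ?R..?R}" for y
  proof -
    have "fib h y \<le> (\<integral>\<^sup>+s. C * indicator {- ?R..?R} s \<partial>lborel)"
      unfolding fib_def using W assms(2)
      by (intro nn_integral_mono) (auto split: split_indicator)
    then show ?thesis
      by (simp add: nn_integral_cmult)
  qed
  moreover have "C * emeasure lborel {- ?R..?R} < top"
    using assms(1) by (simp add: ennreal_mult_less_top emeasure_lborel_Icc_eq)
  ultimately show ?thesis by blast
qed

end

section \<open>Walks along several near-linear fibrations\<close>

text \<open>
The next three constants depend on the linear data and on the number of steps, but not on the maps or
on the neighbourhood. This is all that matters about them: \<open>\<eta>\<close> is chosen after them.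
\<close>

definition frame_bound :: "('n::finite \<Rightarrow> real ^ 'n) \<Rightarrow> ('n \<Rightarrow> real ^ 'n) \<Rightarrow> real" where
  "frame_bound l w = 1 + (\<Sum>j\<in>UNIV. norm (w j) + norm (l j) * norm (w j))"

primrec route_err :: "real \<Rightarrow> nat \<Rightarrow> real" where
  "route_err b 0 = 0"
| "route_err b (Suc k) = (2 * b + 2) * (route_err b k + (b + 1) ^ k)"

definition end_err :: "('n::finite \<Rightarrow> real ^ 'n) \<Rightarrow> ('n \<Rightarrow> real ^ 'n) \<Rightarrow> nat \<Rightarrow> real" where
  "end_err l w k = (let b = frame_bound l w in
     (\<Sum>j\<in>UNIV. norm (l j)) * ((b + 1) ^ k + (1 + b) * route_err b k))"

lemma frame_bound_ge_1: "frame_bound l w \<ge> 1"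
  by (simp add: frame_bound_def sum_nonneg)

lemma route_err_nonneg: "b \<ge> 0 \<Longrightarrow> route_err b k \<ge> 0"
  by (induction k) simp_all

definition column_matrix :: "('n \<Rightarrow> real ^ 'n) \<Rightarrow> real ^ 'n ^ 'n::finite" where
  "column_matrix w = (\<chi> i j. w j $ i)"

lemma column_matrix_mult: "column_matrix w *v \<sigma> = (\<Sum>j\<in>UNIV. \<sigma> $ j *\<^sub>R w j)"
  by (simp add: column_matrix_def matrix_vector_mult_def vec_eq_iff mult.commute)

text \<open>
The vectors \<open>w j\<close> are the fibre directions at the origin. With the dual basis \<open>l\<close> as fibre parameters,
following the linear fibres of family \<open>j\<close> changes the \<open>j\<close>-th dual coordinate and no other.
\<close>

locale near_linear_family =
  fixes V :: "(real ^ 'n) set" and p :: "'n \<Rightarrow> real ^ 'n \<Rightarrow> real ^ 'm"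
    and A :: "'n \<Rightarrow> real ^ 'n ^ 'm" and l w :: "'n \<Rightarrow> real ^ 'n" and \<eta> :: real
  assumes fibration: "near_linear_fibration V (p j) (A j) (l j) \<eta>"
    and \<eta>_half: "\<eta> \<le> 1 / 2"
    and biorthogonal: "l i \<bullet> w j = (if i = j then 1 else 0)"
    and kernel: "A j *v w j = 0"
begin

sublocale fib: near_linear_fibration V "p j" "A j" "l j" \<eta> for j
  by (rule fibration)

sublocale fibre_system "density lborel (indicator V)" lborel p "\<lambda>j. fib.fib j"
  "ennreal ((1 / (1 - \<eta>)) ^ CARD('n))"
proof
  let ?c = "ennreal ((1 / (1 - \<eta>)) ^ CARD('n))"
  fix j
  show "p j \<in> measurable (density lborel (indicator V)) lborel"
    using fib.p by simp
  fix h :: "real ^ 'n \<Rightarrow> ennreal"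
  show "fib.fib j h \<in> borel_measurable lborel" if "h \<in> borel_measurable (density lborel (indicator V))"
    using that fib.fib_measurable by simp
  show "\<exists>C'<top. \<forall>y. fib.fib j h y \<le> C'" if "C < top" "\<And>x. h x \<le> C" for C
    using fib.fib_bounded[OF that] by simp
  fix a :: "real ^ 'm \<Rightarrow> ennreal"
  assume "a \<in> borel_measurable lborel" "h \<in> borel_measurable (density lborel (indicator V))"
  then have a [measurable]: "a \<in> borel_measurable borel" and h [measurable]: "h \<in> borel_measurable borel"
    by simp_all
  have [measurable]: "V \<in> sets borel" using fib.open_V by simp
  have [measurable]: "p j \<in> borel_measurable borel" by (rule fib.p)
  have "(\<integral>\<^sup>+x. a (p j x) * h x \<partial>density lborel (indicator V))
      = (\<integral>\<^sup>+x. indicator V x * (a (p j x) * h x) \<partial>lborel)"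
    by (subst nn_integral_density) simp_all
  then show "(\<integral>\<^sup>+x. a (p j x) * h x \<partial>density lborel (indicator V)) \<le> ?c * (\<integral>\<^sup>+y. a y * fib.fib j h y \<partial>lborel)"
    "(\<integral>\<^sup>+y. a y * fib.fib j h y \<partial>lborel) \<le> ?c * (\<integral>\<^sup>+x. a (p j x) * h x \<partial>density lborel (indicator V))"
    using fib.le_fib[OF a h] fib.fib_le[OF a h] by simp_all
qed

text \<open>
\<open>move j x t\<close> is the point on the fibre of \<open>p j\<close> through \<open>x\<close> with parameter value \<open>l j \<bullet> _ = t\<close>, if
there is one in \<open>V\<close>; the parameter is absolute and not relative to \<open>x\<close>. A walk is \<open>admissible\<close> if all
its points exist in \<open>V\<close>.
\<close>

definition move :: "'n \<Rightarrow> real ^ 'n \<Rightarrow> real \<Rightarrow> real ^ 'n" where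
  "move j x t = fib.\<Psi> j (p j x, t)"

primrec route :: "'n list \<Rightarrow> real ^ 'n \<Rightarrow> ('n \<Rightarrow> real) \<Rightarrow> real ^ 'n" where
  "route [] x s = x"
| "route (j # js) x s = route js (move j x (s j)) s"

primrec admissible :: "'n list \<Rightarrow> real ^ 'n \<Rightarrow> ('n \<Rightarrow> real) \<Rightarrow> bool" where
  "admissible [] x s \<longleftrightarrow> True"
| "admissible (j # js) x s \<longleftrightarrow> (p j x, s j) \<in> fib.W j \<and> admissible js (move j x (s j)) s"

lemma route_cong: "(\<And>j. j \<in> set js \<Longrightarrow> s j = s' j) \<Longrightarrow> route js x s = route js x s'"
  and admissible_cong: "(\<And>j. j \<in> set js \<Longrightarrow> s j = s' j) \<Longrightarrow> admissible js x s = admissible js x s'"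
  by (induction js arbitrary: x) auto

lemma move_in: "(p j x, t) \<in> fib.W j \<Longrightarrow> move j x t \<in> V"
  unfolding move_def by (rule fib.\<Psi>_in)

lemma route_in: "x \<in> V \<Longrightarrow> admissible js x s \<Longrightarrow> route js x s \<in> V"
  by (induction js arbitrary: x) (simp_all add: move_in)

lemma coords_measurable:
  assumes "j \<in> I"
  shows "(\<lambda>z. (p j (fst z), snd z j)) \<in> borel_measurable (borel \<Otimes>\<^sub>M (\<Pi>\<^sub>M i\<in>I. lborel))"
proof (rule borel_measurable_Pair)
  show "(\<lambda>z. p j (fst z)) \<in> borel_measurable (borel \<Otimes>\<^sub>M (\<Pi>\<^sub>M i\<in>I. lborel))"
    by (rule measurable_compose[OF measurable_fst fib.p])
  have "(\<lambda>s. s j) \<in> measurable (\<Pi>\<^sub>M i\<in>I. lborel) lborel"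
    using assms by (rule measurable_component_singleton)
  then show "(\<lambda>z. snd z j) \<in> borel_measurable (borel \<Otimes>\<^sub>M (\<Pi>\<^sub>M i\<in>I. lborel))"
    using measurable_compose[OF measurable_snd] by (simp add: measurable_lborel1)
qed

lemma move_measurable:
  assumes "j \<in> I"
  shows "(\<lambda>z. (move j (fst z) (snd z j), snd z)) \<in>
    measurable (borel \<Otimes>\<^sub>M (\<Pi>\<^sub>M i\<in>I. lborel)) (borel \<Otimes>\<^sub>M (\<Pi>\<^sub>M i\<in>I. lborel))"
  unfolding move_def
  by (intro measurable_Pair measurable_snd measurable_compose[OF coords_measurable[OF assms] fib.\<Psi>_measurable])

lemma route_measurable:
  "set js \<subseteq> I \<Longrightarrow> (\<lambda>z. route js (fst z) (snd z)) \<in> borel_measurable (borel \<Otimes>\<^sub>M (\<Pi>\<^sub>M i\<in>I. lborel))"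
proof (induction js)
  case (Cons j js)
  then have "j \<in> I" "set js \<subseteq> I" by simp_all
  from measurable_compose[OF move_measurable[OF this(1)] Cons.IH[OF this(2)]] show ?case
    by simp
qed simp

lemma admissible_measurable:
  "set js \<subseteq> I \<Longrightarrow> Measurable.pred (borel \<Otimes>\<^sub>M (\<Pi>\<^sub>M i\<in>I. lborel)) (\<lambda>z. admissible js (fst z) (snd z))"
proof (induction js)
  case (Cons j js)
  then have "j \<in> I" "set js \<subseteq> I" by simp_all
  from measurable_compose[OF move_measurable[OF this(1)] Cons.IH[OF this(2)]]
  have "Measurable.pred (borel \<Otimes>\<^sub>M (\<Pi>\<^sub>M i\<in>I. lborel)) (\<lambda>z. admissible js (move j (fst z) (snd z j)) (snd z))"
    by simp
  moreover have "Measurable.pred (borel \<Otimes>\<^sub>M (\<Pi>\<^sub>M i\<in>I. lborel)) (\<lambda>z. (p j (fst z), snd z j) \<in> fib.W j)"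
    using Cons.prems by (intro pred_sets2[OF fib.W_measurable coords_measurable]) simp
  ultimately show ?case
    by (simp add: pred_intros_logic)
qed simp

lemma walk_integrand_measurable:
  assumes "set js \<subseteq> I" "B \<in> borel_measurable borel"
  shows "(\<lambda>s. if admissible js x s then B (route js x s) else 0 :: ennreal) \<in> borel_measurable (\<Pi>\<^sub>M i\<in>I. lborel)"
proof -
  have "Measurable.pred (\<Pi>\<^sub>M i\<in>I. lborel) (admissible js x)"
    using measurable_compose[OF measurable_Pair1' admissible_measurable[OF assms(1)], of x] by simp
  moreover have "(\<lambda>s. B (route js x s)) \<in> borel_measurable (\<Pi>\<^sub>M i\<in>I. lborel)"
    using measurable_compose[OF measurable_compose[OF measurable_Pair1' route_measurable[OF assms(1)], of x] assms(2)] by simp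
  ultimately show ?thesis
    by (intro measurable_If) simp_all
qed

text \<open>
Since no family is repeated, the parameters of a walk may be indexed by the families themselves.
\<close>

lemma walk_eq_route_integral:
  assumes "B \<in> borel_measurable borel" "distinct js"
  shows "walk js B x = (\<integral>\<^sup>+s. (if admissible js x s then B (route js x s) else 0) \<partial>(\<Pi>\<^sub>M i\<in>set js. lborel))"
  using assms(2)
proof (induction js arbitrary: x)
  case Nil
  interpret product_sigma_finite "\<lambda>_::'n. lborel :: real measure" ..
  show ?case by (simp add: space_PiM_empty)
next
  case (Cons j js)
  interpret product_sigma_finite "\<lambda>_::'n. lborel :: real measure" ..
  let ?f = "\<lambda>js x s. if admissible js x s then B (route js x s) else 0"
  have j: "j \<notin> set js" using Cons.prems by simp
  have "(\<integral>\<^sup>+s. ?f (j # js) x s \<partial>(\<Pi>\<^sub>M i\<in>set (j # js). lborel))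
      = (\<integral>\<^sup>+t. \<integral>\<^sup>+s. ?f (j # js) x (s(j := t)) \<partial>(\<Pi>\<^sub>M i\<in>set js. lborel) \<partial>lborel)"
    using product_nn_integral_insert_rev[OF _ j, of "?f (j # js) x"] walk_integrand_measurable[of "j # js" "set (j # js)" B x] assms(1)
    by simp
  also have "\<dots> = (\<integral>\<^sup>+t. indicator (fib.W j) (p j x, t) * walk js B (move j x t) \<partial>lborel)"
  proof (rule nn_integral_cong)
    fix t
    have "route js y (s(j := t)) = route js y s" for y s
      by (rule route_cong) (use j in auto)
    moreover have "admissible js y (s(j := t)) = admissible js y s" for y s
      by (rule admissible_cong) (use j in auto)
    ultimately show "(\<integral>\<^sup>+s. ?f (j # js) x (s(j := t)) \<partial>(\<Pi>\<^sub>M i\<in>set js. lborel))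
        = indicator (fib.W j) (p j x, t) * walk js B (move j x t)"
      using Cons by (simp add: indicator_def cong: if_cong)
  qed
  also have "\<dots> = walk (j # js) B x"
    by (simp add: fib.fib_def move_def)
  finally show ?case ..
qed

text \<open>
The model of \<^term>\<open>move\<close> for linear fibrations, acting on differences of points and of parameters.
\<close>

definition lin_step :: "'n \<Rightarrow> real ^ 'n \<Rightarrow> real \<Rightarrow> real ^ 'n" where
  "lin_step j v t = v + (t - l j \<bullet> v) *\<^sub>R w j"

primrec lin_route :: "'n list \<Rightarrow> real ^ 'n \<Rightarrow> real ^ 'n \<Rightarrow> real ^ 'n" where
  "lin_route [] v \<sigma> = v"
| "lin_route (j # js) v \<sigma> = lin_route js (lin_step j v (\<sigma> $ j)) \<sigma>"

lemma lin_step_diff: "lin_step j v t - lin_step j v' t' = lin_step j (v - v') (t - t')"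
  by (simp add: lin_step_def algebra_simps inner_diff_right)

lemma lin_route_diff: "lin_route js v \<sigma> - lin_route js v' \<sigma>' = lin_route js (v - v') (\<sigma> - \<sigma>')"
  by (induction js arbitrary: v v') (simp_all add: lin_step_diff)

lemma norm_lin_step: "norm (lin_step j v t) \<le> frame_bound l w * (norm v + \<bar>t\<bar>)"
proof -
  let ?b = "frame_bound l w"
  have "norm (w j) + norm (l j) * norm (w j) \<le> (\<Sum>j\<in>UNIV. norm (w j) + norm (l j) * norm (w j))"
    by (rule member_le_sum) simp_all
  then have b: "1 + norm (w j) + norm (l j) * norm (w j) \<le> ?b"
    by (simp add: frame_bound_def)
  have "norm (lin_step j v t) \<le> norm v + \<bar>t - l j \<bullet> v\<bar> * norm (w j)"
    unfolding lin_step_def by (rule order_trans[OF norm_triangle_ineq]) simp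
  also have "\<bar>t - l j \<bullet> v\<bar> \<le> \<bar>t\<bar> + norm (l j) * norm v"
    using Cauchy_Schwarz_ineq2[of "l j" v] by simp
  finally have "norm (lin_step j v t) \<le> (1 + norm (l j) * norm (w j)) * norm v + norm (w j) * \<bar>t\<bar>"
    by (simp add: algebra_simps mult_right_mono)
  also have "\<dots> \<le> ?b * norm v + ?b * \<bar>t\<bar>"
  proof -
    have "0 \<le> norm (w j)" "0 \<le> norm (l j) * norm (w j)" by simp_all
    with b have "1 + norm (l j) * norm (w j) \<le> ?b" "norm (w j) \<le> ?b" by linarith+
    then show ?thesis by (intro add_mono mult_right_mono) simp_all
  qed
  finally show ?thesis
    by (simp add: distrib_left)
qed

lemma norm_lin_route: "norm (lin_route js v \<sigma>) \<le> (frame_bound l w + 1) ^ length js * (norm v + norm \<sigma>)"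
proof (induction js arbitrary: v)
  case (Cons j js)
  let ?b = "frame_bound l w"
  have b: "?b \<ge> 1" by (rule frame_bound_ge_1)
  have "norm (lin_step j v (\<sigma> $ j)) \<le> ?b * (norm v + norm \<sigma>)"
    using norm_lin_step[of j v "\<sigma> $ j"] component_le_norm_cart[of \<sigma> j] b
    by (smt (verit) mult_left_mono)
  then have "norm (lin_step j v (\<sigma> $ j)) + norm \<sigma> \<le> (?b + 1) * (norm v + norm \<sigma>)"
    using norm_ge_zero[of v] by (simp add: algebra_simps del: norm_ge_zero)
  then have "(?b + 1) ^ length js * (norm (lin_step j v (\<sigma> $ j)) + norm \<sigma>)
      \<le> (?b + 1) ^ length js * ((?b + 1) * (norm v + norm \<sigma>))"
    using b by (intro mult_left_mono) simp_all
  then show ?case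
    using Cons[of "lin_step j v (\<sigma> $ j)"] by (simp add: mult_ac)
qed simp

text \<open>
By biorthogonality the steps do not interact.
\<close>

lemma lin_route_eq:
  "distinct js \<Longrightarrow> lin_route js v \<sigma> = v + (\<Sum>j\<in>set js. (\<sigma> $ j - l j \<bullet> v) *\<^sub>R w j)"
proof (induction js arbitrary: v)
  case (Cons j js)
  have "l i \<bullet> lin_step j v (\<sigma> $ j) = l i \<bullet> v" if "i \<in> set js" for i
    using that Cons.prems by (auto simp: lin_step_def inner_add_right biorthogonal)
  then show ?case
    using Cons by (simp add: lin_step_def)
qed simp

lemma coords_inv_shift:
  "coords_inv (A j) (l j) (p j x, t) = fib.G j x + (t - l j \<bullet> x) *\<^sub>R w j"
proof -
  have vertical: "coords_inv (A j) (l j) (0, s) = s *\<^sub>R w j" for s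
  proof -
    have "fib.L j (s *\<^sub>R w j) = (0, s)"
      by (simp add: fib.L_def matrix_vector_mult_scaleR kernel biorthogonal)
    then show ?thesis by (metis fib.coords_inv_L)
  qed
  have "(p j x, t) = fib.\<Phi> j x + (0, t - l j \<bullet> x)"
    by (simp add: fib.\<Phi>_def)
  then show ?thesis
    by (simp add: linear_add[OF linear_coords_inv] vertical fib.G_def)
qed

text \<open>
In the coordinates \<open>G\<close> a move is exactly a straight step: it shifts \<open>G j x\<close> by a multiple of \<open>w j\<close>. The only
errors come from \<open>G\<close> at the two ends of the move.
\<close>

lemma move_near:
  assumes x: "x \<in> V" "x' \<in> V" and ok: "(p j x, t) \<in> fib.W j" "(p j x', t') \<in> fib.W j"
  defines "N \<equiv> norm (x - x') + \<bar>t - t'\<bar>"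
  shows "norm (move j x t - move j x' t' - lin_step j (x - x') (t - t')) \<le> \<eta> * (2 * frame_bound l w + 2) * N"
    and "norm (move j x t - move j x' t') \<le> (2 * frame_bound l w + 1) * N"
proof -
  let ?b = "frame_bound l w"
  have b: "?b \<ge> 1" by (rule frame_bound_ge_1)
  have N: "N \<ge> 0" "norm (x - x') \<le> N" by (simp_all add: N_def)
  note eta = fib.\<eta>(1)
  have G_move: "fib.G j (move j x t) = fib.G j x + (t - l j \<bullet> x) *\<^sub>R w j"
    if "(p j x, t) \<in> fib.W j" for x t
    unfolding coords_inv_shift[symmetric] using that by (simp add: fib.G_def move_def fib.\<Phi>_\<Psi>)
  let ?d = "move j x t - move j x' t'"
  let ?e1 = "fib.G j (move j x t) - fib.G j (move j x' t') - ?d"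
  let ?e2 = "fib.G j x - fib.G j x' - (x - x')"
  have e1: "norm ?e1 \<le> \<eta> * norm ?d"
    using ok by (intro fib.G_near move_in)
  have e2: "norm ?e2 \<le> \<eta> * norm (x - x')"
    using x by (intro fib.G_near)
  have eq: "?d - lin_step j (x - x') (t - t') = ?e2 - ?e1"
    using ok by (simp add: G_move lin_step_def algebra_simps inner_diff_right)
  have le1: "norm (?d - lin_step j (x - x') (t - t')) \<le> \<eta> * norm (x - x') + \<eta> * norm ?d"
    unfolding eq using e1 e2 norm_triangle_ineq4[of ?e2 ?e1] by linarith
  have "norm (lin_step j (x - x') (t - t')) \<le> ?b * N"
    unfolding N_def by (rule norm_lin_step)
  moreover have "norm ?d \<le> norm (?d - lin_step j (x - x') (t - t')) + norm (lin_step j (x - x') (t - t'))"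
    by (metis norm_triangle_sub add.commute)
  moreover have "\<eta> * norm (x - x') \<le> 1 / 2 * N"
    using \<eta>_half eta N by (intro mult_mono) simp_all
  moreover have "\<eta> * norm ?d \<le> 1 / 2 * norm ?d"
    using \<eta>_half by (intro mult_right_mono) simp_all
  ultimately show d: "norm ?d \<le> (2 * ?b + 1) * N"
    using le1 by (simp add: algebra_simps)
  have "norm (x - x') + norm ?d \<le> (2 * ?b + 2) * N"
    using d N by (simp add: algebra_simps)
  then have "\<eta> * (norm (x - x') + norm ?d) \<le> \<eta> * ((2 * ?b + 2) * N)"
    using eta by (rule mult_left_mono)
  then show "norm (?d - lin_step j (x - x') (t - t')) \<le> \<eta> * (2 * ?b + 2) * N"
    using le1 by (simp add: algebra_simps)
qed

text \<open>
The error is proportional to the distance between the two walks, not to the size of \<open>V\<close>; this scale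
invariance is what makes differentials that are merely continuous sufficient.
\<close>

lemma route_near:
  assumes "x \<in> V" "x' \<in> V" "admissible js x (vec_nth \<tau>)" "admissible js x' (vec_nth \<tau>')"
  shows "norm (route js x (vec_nth \<tau>) - route js x' (vec_nth \<tau>') - lin_route js (x - x') (\<tau> - \<tau>'))
    \<le> \<eta> * route_err (frame_bound l w) (length js) * (norm (x - x') + norm (\<tau> - \<tau>'))"
  using assms
proof (induction js arbitrary: x x')
  case Nil
  then show ?case by simp
next
  case (Cons j js)
  let ?b = "frame_bound l w" and ?k = "length js"
  let ?E = "route_err ?b ?k"
  let ?N = "norm (x - x') + norm (\<tau> - \<tau>')"
  let ?y = "move j x (\<tau> $ j)" and ?y' = "move j x' (\<tau>' $ j)"
  let ?s = "lin_step j (x - x') ((\<tau> - \<tau>') $ j)"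
  have b: "?b \<ge> 1" by (rule frame_bound_ge_1)
  have E: "?E \<ge> 0" using b by (intro route_err_nonneg) simp
  note eta = fib.\<eta>(1)
  have ok: "(p j x, \<tau> $ j) \<in> fib.W j" "(p j x', \<tau>' $ j) \<in> fib.W j"
    using Cons.prems by simp_all
  have comp: "norm (x - x') + \<bar>\<tau> $ j - \<tau>' $ j\<bar> \<le> ?N"
    using component_le_norm_cart[of "\<tau> - \<tau>'" j] by simp
  have "\<eta> * (2 * ?b + 2) * (norm (x - x') + \<bar>\<tau> $ j - \<tau>' $ j\<bar>) \<le> \<eta> * (2 * ?b + 2) * ?N"
    using comp eta b by (intro mult_left_mono) simp_all
  then have m1: "norm (?y - ?y' - ?s) \<le> \<eta> * (2 * ?b + 2) * ?N"
    using move_near(1)[OF Cons.prems(1,2) ok] by simp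
  have "(2 * ?b + 1) * (norm (x - x') + \<bar>\<tau> $ j - \<tau>' $ j\<bar>) \<le> (2 * ?b + 1) * ?N"
    using comp b by (intro mult_left_mono) simp_all
  then have "norm (?y - ?y') \<le> (2 * ?b + 1) * ?N"
    using move_near(2)[OF Cons.prems(1,2) ok] by simp
  then have m2: "norm (?y - ?y') + norm (\<tau> - \<tau>') \<le> (2 * ?b + 2) * ?N"
    using norm_ge_zero[of "x - x'"] by (simp add: algebra_simps del: norm_ge_zero)
  let ?P = "route js ?y (vec_nth \<tau>) - route js ?y' (vec_nth \<tau>')"
  have "norm (?P - lin_route js (?y - ?y') (\<tau> - \<tau>')) \<le> \<eta> * ?E * (norm (?y - ?y') + norm (\<tau> - \<tau>'))"
    using Cons.prems by (intro Cons.IH move_in) simp_all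
  also have "\<dots> \<le> \<eta> * ?E * ((2 * ?b + 2) * ?N)"
    using m2 eta E by (intro mult_left_mono) simp_all
  finally have t1: "norm (?P - lin_route js (?y - ?y') (\<tau> - \<tau>')) \<le> \<eta> * ?E * ((2 * ?b + 2) * ?N)" .
  have "lin_route js (?y - ?y') (\<tau> - \<tau>') - lin_route js ?s (\<tau> - \<tau>') = lin_route js (?y - ?y' - ?s) 0"
    by (simp add: lin_route_diff)
  then have "norm (lin_route js (?y - ?y') (\<tau> - \<tau>') - lin_route js ?s (\<tau> - \<tau>'))
      \<le> (?b + 1) ^ ?k * norm (?y - ?y' - ?s)"
    using norm_lin_route[of js "?y - ?y' - ?s" 0] by simp
  also have "\<dots> \<le> (?b + 1) ^ ?k * (\<eta> * (2 * ?b + 2) * ?N)"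
    using m1 b by (intro mult_left_mono) simp_all
  finally have t2: "norm (lin_route js (?y - ?y') (\<tau> - \<tau>') - lin_route js ?s (\<tau> - \<tau>'))
      \<le> (?b + 1) ^ ?k * (\<eta> * (2 * ?b + 2) * ?N)" .
  have "norm (?P - lin_route js ?s (\<tau> - \<tau>'))
      \<le> \<eta> * ?E * ((2 * ?b + 2) * ?N) + (?b + 1) ^ ?k * (\<eta> * (2 * ?b + 2) * ?N)"
    using norm_triangle_mono[OF t1 t2] by (simp only: diff_add_cancel add_diff_eq)
  also have "\<dots> = \<eta> * route_err ?b (length (j # js)) * ?N"
    by (simp add: algebra_simps)
  finally show ?case by simp
qed

text \<open>
The family \<open>k\<close> along which no step is taken contributes its parameter \<open>\<tau> $ k\<close> as a dummy coordinate,
so that parameters and end data both live in \<open>n\<close> dimensions.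
\<close>

definition end_coords :: "'n \<Rightarrow> 'n list \<Rightarrow> real ^ 'n \<Rightarrow> real ^ 'n \<Rightarrow> (real ^ 'm) \<times> real" where
  "end_coords k js x \<tau> = (p k (route js x (vec_nth \<tau>)), \<tau> $ k)"

definition dual_coords :: "real ^ 'n \<Rightarrow> real ^ 'n" where
  "dual_coords y = (\<chi> j. l j \<bullet> y)"

lemma linear_dual_coords: "linear dual_coords"
  by (rule linearI) (simp_all add: dual_coords_def vec_eq_iff inner_add_right)

lemma dual_coords_column_matrix: "dual_coords (column_matrix w *v \<sigma>) = \<sigma>"
  by (simp add: dual_coords_def column_matrix_mult vec_eq_iff inner_sum_right biorthogonal if_distrib cong: if_cong)

lemma column_matrix_dual_coords: "column_matrix w *v dual_coords y = y"
  and det_column_matrix: "det (column_matrix w) \<noteq> 0"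
proof -
  define D :: "real ^ 'n ^ 'n" where "D = (\<chi> j. l j)"
  have D: "D *v y = dual_coords y" for y
    by (simp add: D_def dual_coords_def matrix_vector_mult_def inner_vec_def)
  have "D ** column_matrix w = mat 1"
    by (simp add: matrix_eq matrix_vector_mul_assoc[symmetric] D dual_coords_column_matrix)
  then have *: "column_matrix w ** D = mat 1"
    by (simp add: matrix_left_right_inverse)
  then show "column_matrix w *v dual_coords y = y"
    by (metis D matrix_vector_mul_assoc matrix_vector_mul_lid)
  show "det (column_matrix w) \<noteq> 0"
    using * by (metis det_I det_mul mult_zero_left zero_neq_one)
qed

lemma norm_dual_coords: "norm (dual_coords y) \<le> (\<Sum>j\<in>UNIV. norm (l j)) * norm y"
proof -
  have "norm (dual_coords y) \<le> (\<Sum>j\<in>UNIV. \<bar>dual_coords y $ j\<bar>)"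
    by (rule norm_le_l1_cart)
  also have "\<dots> \<le> (\<Sum>j\<in>UNIV. norm (l j) * norm y)"
    by (intro sum_mono) (simp add: dual_coords_def Cauchy_Schwarz_ineq2)
  finally show ?thesis by (simp add: sum_distrib_right)
qed

text \<open>
For linear fibrations the end coordinates depend on the parameters through \<open>\<tau> \<mapsto> \<Sum>\<^sub>j \<tau>\<^sub>j w\<^sub>j\<close> alone,
because the dummy coordinate acts like a last step along family \<open>k\<close>, which \<open>p k\<close> does not see. Undoing
this linear map with the dual basis leaves a perturbation of the identity.
\<close>

lemma end_coords_near:
  assumes x: "x \<in> V" and ok: "admissible js x (vec_nth \<tau>)" "admissible js x (vec_nth \<tau>')"
    and js: "distinct (k # js)" "set (k # js) = UNIV"
  defines "g \<equiv> \<lambda>\<tau>. dual_coords (coords_inv (A k) (l k) (end_coords k js x \<tau>))"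
  shows "norm (g \<tau> - g \<tau>' - (\<tau> - \<tau>')) \<le> \<eta> * end_err l w (length js) * norm (\<tau> - \<tau>')"
proof -
  let ?b = "frame_bound l w" and ?k = "length js"
  let ?E = "route_err ?b ?k"
  let ?X = "route js x (vec_nth \<tau>)" and ?X' = "route js x (vec_nth \<tau>')"
  let ?\<sigma> = "\<tau> - \<tau>'" and ?\<xi> = "route js x (vec_nth \<tau>) - route js x (vec_nth \<tau>')"
  let ?Y = "coords_inv (A k) (l k) (end_coords k js x \<tau>) - coords_inv (A k) (l k) (end_coords k js x \<tau>')"
  have b: "?b \<ge> 1" by (rule frame_bound_ge_1)
  have E: "?E \<ge> 0" using b by (intro route_err_nonneg) simp
  note eta = fib.\<eta>(1)
  have inv: "coords_inv (A k) (l k) (end_coords k js x \<tau>)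
      = fib.G k (route js x (vec_nth \<tau>)) + (\<tau> $ k - l k \<bullet> route js x (vec_nth \<tau>)) *\<^sub>R w k" for \<tau>
    by (simp add: end_coords_def coords_inv_shift)
  let ?e1 = "?\<xi> - lin_route js 0 ?\<sigma>"
  let ?e2 = "fib.G k ?X - fib.G k ?X' - ?\<xi>"
  have e1: "norm ?e1 \<le> \<eta> * ?E * norm ?\<sigma>"
    using route_near[OF x x ok] by simp
  have e2: "norm ?e2 \<le> \<eta> * norm ?\<xi>"
    using x ok by (intro fib.G_near route_in)
  have "norm ?\<xi> \<le> norm ?e1 + norm (lin_route js 0 ?\<sigma>)"
    by (metis norm_triangle_sub add.commute)
  also have "\<dots> \<le> ?E * norm ?\<sigma> + (?b + 1) ^ ?k * norm ?\<sigma>"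
  proof (rule add_mono)
    have "\<eta> * (?E * norm ?\<sigma>) \<le> 1 * (?E * norm ?\<sigma>)"
      using E \<eta>_half by (intro mult_right_mono) simp_all
    then show "norm ?e1 \<le> ?E * norm ?\<sigma>" using e1 by simp
    show "norm (lin_route js 0 ?\<sigma>) \<le> (?b + 1) ^ ?k * norm ?\<sigma>"
      using norm_lin_route[of js 0 ?\<sigma>] by simp
  qed
  finally have "\<eta> * norm ?\<xi> \<le> \<eta> * (?E * norm ?\<sigma> + (?b + 1) ^ ?k * norm ?\<sigma>)"
    using eta by (rule mult_left_mono)
  then have e2': "norm ?e2 \<le> \<eta> * (?E * norm ?\<sigma> + (?b + 1) ^ ?k * norm ?\<sigma>)"
    using e2 by linarith
  have "norm (lin_step k ?e1 0) \<le> ?b * norm ?e1"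
    using norm_lin_step[of k ?e1 0] by simp
  also have "\<dots> \<le> ?b * (\<eta> * ?E * norm ?\<sigma>)"
    using e1 b by (intro mult_left_mono) simp_all
  finally have e3: "norm (lin_step k ?e1 0) \<le> ?b * (\<eta> * ?E * norm ?\<sigma>)" .
  have "lin_step k (lin_route js 0 ?\<sigma>) (?\<sigma> $ k) = column_matrix w *v ?\<sigma>"
  proof -
    have "l k \<bullet> (\<Sum>j\<in>set js. ?\<sigma> $ j *\<^sub>R w j) = 0"
      using js(1) by (auto simp: inner_sum_right biorthogonal intro!: sum.neutral)
    moreover have "column_matrix w *v ?\<sigma> = (\<Sum>j\<in>set (k # js). ?\<sigma> $ j *\<^sub>R w j)"
      unfolding js(2) by (rule column_matrix_mult)
    ultimately show ?thesis
      using js(1) by (simp add: lin_step_def lin_route_eq)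
  qed
  moreover have "?Y = ?e2 + lin_step k ?\<xi> (?\<sigma> $ k)"
    unfolding inv by (simp add: lin_step_def algebra_simps inner_diff_right)
  moreover have "lin_step k ?\<xi> (?\<sigma> $ k) = lin_step k (lin_route js 0 ?\<sigma>) (?\<sigma> $ k) + lin_step k ?e1 0"
    using lin_step_diff[of k ?\<xi> "?\<sigma> $ k" "lin_route js 0 ?\<sigma>" "?\<sigma> $ k"] by (simp add: algebra_simps)
  ultimately have "?Y - column_matrix w *v ?\<sigma> = ?e2 + lin_step k ?e1 0"
    by simp
  then have Y: "norm (?Y - column_matrix w *v ?\<sigma>)
      \<le> \<eta> * (?E * norm ?\<sigma> + (?b + 1) ^ ?k * norm ?\<sigma>) + ?b * (\<eta> * ?E * norm ?\<sigma>)"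
    using norm_triangle_mono[OF e2' e3] by simp
  have "g \<tau> - g \<tau>' - ?\<sigma> = dual_coords (?Y - column_matrix w *v ?\<sigma>)"
    unfolding g_def by (simp add: linear_diff[OF linear_dual_coords] dual_coords_column_matrix)
  then have "norm (g \<tau> - g \<tau>' - ?\<sigma>) \<le> (\<Sum>j\<in>UNIV. norm (l j)) * norm (?Y - column_matrix w *v ?\<sigma>)"
    by (simp add: norm_dual_coords)
  also have "\<dots> \<le> (\<Sum>j\<in>UNIV. norm (l j)) *
      (\<eta> * (?E * norm ?\<sigma> + (?b + 1) ^ ?k * norm ?\<sigma>) + ?b * (\<eta> * ?E * norm ?\<sigma>))"
    using Y by (intro mult_left_mono sum_nonneg) simp_all
  also have "\<dots> = \<eta> * end_err l w (length js) * norm ?\<sigma>"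
    by (simp add: end_err_def Let_def algebra_simps)
  finally show ?thesis .
qed

text \<open>
The factor \<open>det (column_matrix w)\<close> is where the constant of the theorem comes from: it is the volume factor of
the linear model of the end map, since the linear coordinates of each fibration have determinant \<open>\<plusminus>1\<close>.
\<close>

lemma walk_le:
  assumes x: "x \<in> V" and f: "f \<in> borel_measurable borel"
    and js: "distinct (k # js)" "set (k # js) = UNIV"
    and small: "\<eta> * end_err l w (length js) < 1"
  shows "ennreal \<bar>det (column_matrix w)\<bar> * walk js (\<lambda>x. f (p k x)) x \<le>
    ennreal ((1 / (1 - \<eta> * end_err l w (length js))) ^ CARD('n)) * (\<integral>\<^sup>+y. f y \<partial>lborel)"
proof -
  define \<eta>' where "\<eta>' = \<eta> * end_err l w (length js)"
  define S where "S = {\<tau>. admissible js x (vec_nth \<tau>)}"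
  define H where "H z = f (fst z) * indicator {0..1} (snd z)" for z :: "(real ^ 'm) \<times> real"
  define g where "g \<tau> = dual_coords (coords_inv (A k) (l k) (end_coords k js x \<tau>))" for \<tau>
  define F where "F s = (if admissible js x s then f (p k (route js x s)) else 0)" for s
  have fp: "(\<lambda>x. f (p k x)) \<in> borel_measurable borel"
    by (rule measurable_compose[OF fib.p f])
  have js_eq: "set js = UNIV - {k}" and k: "k \<notin> set js" using js by auto
  have vec: "(vec_nth :: real ^ 'n \<Rightarrow> 'n \<Rightarrow> real) \<in> measurable borel (\<Pi>\<^sub>M i\<in>UNIV. lborel)"
  proof (rule measurable_PiM_single')
    show "(\<lambda>x :: real ^ 'n. x $ i) \<in> measurable borel (lborel :: real measure)" for i
      using borel_measurable_vec_nth[of i] by simp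
  qed simp
  have F_meas: "F \<in> borel_measurable (\<Pi>\<^sub>M i\<in>UNIV. lborel)"
    unfolding F_def by (rule walk_integrand_measurable[OF _ fp]) simp
  have S [measurable]: "S \<in> sets borel"
  proof -
    have "Measurable.pred borel (\<lambda>\<tau>. admissible js x (vec_nth \<tau>))"
      using measurable_compose[OF vec measurable_compose[OF measurable_Pair1' admissible_measurable[of js UNIV], of x]]
      by simp
    then show ?thesis
      by (simp add: S_def pred_def)
  qed
  have X: "(\<lambda>\<tau>. route js x (vec_nth \<tau>)) \<in> borel_measurable borel"
    using measurable_compose[OF vec measurable_compose[OF measurable_Pair1' route_measurable[of js UNIV], of x]]
    by simp
  have end_meas: "end_coords k js x \<in> borel_measurable borel"
    unfolding end_coords_def[abs_def]
    by (intro borel_measurable_Pair measurable_compose[OF X fib.p] borel_measurable_vec_nth)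
  have g_meas: "g \<in> borel_measurable borel"
    unfolding g_def[abs_def]
    by (rule measurable_compose[OF measurable_compose[OF end_meas borel_measurable_linear[OF linear_coords_inv]]
          borel_measurable_linear[OF linear_dual_coords]])
  have H_meas: "H \<in> borel_measurable borel"
  proof -
    have fst: "fst \<in> borel_measurable (borel :: ((real ^ 'm) \<times> real) measure)"
      and snd: "snd \<in> borel_measurable (borel :: ((real ^ 'm) \<times> real) measure)"
      by (intro borel_measurable_continuous_onI continuous_intros)+
    have ind: "(\<lambda>r :: real. indicator {0..1} r :: ennreal) \<in> borel_measurable borel"
      by simp
    show ?thesis
      unfolding H_def[abs_def]
      by (intro borel_measurable_times_ennreal measurable_compose[OF fst f] measurable_compose[OF snd ind])
  qed
  have "walk js (\<lambda>x. f (p k x)) x = (\<integral>\<^sup>+s. F s \<partial>(\<Pi>\<^sub>M i\<in>UNIV - {k}. lborel))"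
    unfolding F_def using walk_eq_route_integral[OF fp, of js x] js(1) js_eq by simp
  \<comment> \<open>The dummy coordinate is integrated over the unit interval and contributes a factor 1.\<close>
  also have "\<dots> = (\<integral>\<^sup>+s. \<integral>\<^sup>+t. indicator {0..1} ((\<chi> i. (s(k := t)) i) $ k) * F (vec_nth (\<chi> i. (s(k := t)) i)) \<partial>lborel
      \<partial>(\<Pi>\<^sub>M i\<in>UNIV - {k}. lborel))"
  proof (rule nn_integral_cong)
    fix s
    have "vec_nth (\<chi> i. (s(k := t)) i) = s(k := t)" for t :: real
      by auto
    moreover have "F (s(k := t)) = F s" for t
    proof -
      have "route js x (s(k := t)) = route js x s" "admissible js x (s(k := t)) = admissible js x s"
        using k by (auto intro!: route_cong admissible_cong)
      then show ?thesis by (simp add: F_def)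
    qed
    ultimately show "F s = (\<integral>\<^sup>+t. indicator {0..1} ((\<chi> i. (s(k := t)) i) $ k) * F (vec_nth (\<chi> i. (s(k := t)) i)) \<partial>lborel)"
      by (simp add: nn_integral_multc)
  qed
  also have "\<dots> = (\<integral>\<^sup>+\<tau>. indicator {0..1} (\<tau> $ k) * F (vec_nth \<tau>) \<partial>lborel)"
  proof (rule nn_integral_cart_split[symmetric])
    show "(\<lambda>\<tau>. indicator {0..1} (\<tau> $ k) * F (vec_nth \<tau>)) \<in> borel_measurable borel"
      by (intro borel_measurable_times_ennreal measurable_compose[OF vec F_meas]
          measurable_compose[OF borel_measurable_vec_nth borel_measurable_indicator]) simp
  qed
  also have "\<dots> = (\<integral>\<^sup>+\<tau>. indicator S \<tau> * H (fib.L k (column_matrix w *v g \<tau>)) \<partial>lborel)"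
    by (intro nn_integral_cong)
       (auto simp: g_def column_matrix_dual_coords fib.L_coords_inv H_def end_coords_def S_def F_def mult.commute)
  also have "\<dots> \<le> ennreal ((1 / (1 - \<eta>')) ^ DIM(real ^ 'n)) * (\<integral>\<^sup>+\<sigma>. H (fib.L k (column_matrix w *v \<sigma>)) \<partial>lborel)"
  proof (rule nn_integral_expanding[OF refl S g_meas])
    show "0 < 1 / (1 - \<eta>')" using small by (simp add: \<eta>'_def)
    show "(\<lambda>\<sigma>. H (fib.L k (column_matrix w *v \<sigma>))) \<in> borel_measurable borel"
      by (intro measurable_compose[OF _ H_meas] measurable_compose[OF _ borel_measurable_linear[OF fib.linear_L]]
          borel_measurable_linear matrix_vector_mul_linear)
    fix \<tau> \<tau>' assume "\<tau> \<in> S" "\<tau>' \<in> S"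
    then have "norm (g \<tau> - g \<tau>' - (\<tau> - \<tau>')) \<le> \<eta>' * norm (\<tau> - \<tau>')"
      unfolding \<eta>'_def g_def S_def using end_coords_near[OF x _ _ js] by simp
    then show "norm (\<tau> - \<tau>') \<le> 1 / (1 - \<eta>') * norm (g \<tau> - g \<tau>')"
      using small norm_triangle_ineq2[of "\<tau> - \<tau>'" "g \<tau> - g \<tau>'"]
      by (simp add: field_simps norm_minus_commute \<eta>'_def)
  qed
  finally have "ennreal \<bar>det (column_matrix w)\<bar> * walk js (\<lambda>x. f (p k x)) x
      \<le> ennreal \<bar>det (column_matrix w)\<bar> * (ennreal ((1 / (1 - \<eta>')) ^ DIM(real ^ 'n)) *
        (\<integral>\<^sup>+\<sigma>. H (fib.L k (column_matrix w *v \<sigma>)) \<partial>lborel))"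
    by (rule mult_left_mono) simp
  also have "\<dots> = ennreal ((1 / (1 - \<eta>')) ^ CARD('n)) * (ennreal \<bar>det (column_matrix w)\<bar> *
        (\<integral>\<^sup>+\<sigma>. H (fib.L k (column_matrix w *v \<sigma>)) \<partial>lborel))"
    by (simp add: mult.left_commute)
  also have "ennreal \<bar>det (column_matrix w)\<bar> * (\<integral>\<^sup>+\<sigma>. H (fib.L k (column_matrix w *v \<sigma>)) \<partial>lborel)
      = (\<integral>\<^sup>+x. H (fib.L k x) \<partial>lborel)"
    by (intro nn_integral_matrix[OF det_column_matrix, where h = "\<lambda>x. H (fib.L k x)"]
        measurable_compose[OF borel_measurable_linear[OF fib.linear_L] H_meas])
  also have "\<dots> = (\<integral>\<^sup>+z. H z \<partial>lborel)"
    by (rule fib.nn_integral_L[OF H_meas])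
  also have "\<dots> = (\<integral>\<^sup>+y. \<integral>\<^sup>+r. f y * indicator {0..1::real} r \<partial>lborel \<partial>lborel)"
  proof -
    have "H \<in> borel_measurable (lborel \<Otimes>\<^sub>M lborel)"
      using H_meas by (simp add: lborel_prod)
    from lborel.nn_integral_fst[OF this] show ?thesis
      by (simp add: lborel_prod H_def[abs_def])
  qed
  also have "\<dots> = (\<integral>\<^sup>+y. f y \<partial>lborel)"
    by (simp add: nn_integral_cmult)
  finally show ?thesis
    by (simp add: \<eta>'_def)
qed

end

section \<open>The inequality for near-linear submersions\<close>

lemma ennreal_powr_mono:
  assumes "x \<le> y" "0 \<le> a"
  shows "ennreal_powr x a \<le> ennreal_powr y a"
proof (cases "y = top")
  case False
  then have "x \<noteq> top" using assms(1) by (auto simp: top_unique)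
  then show ?thesis
    using False assms
    by (auto simp: ennreal_powr_def less_top intro!: ennreal_leI powr_mono2 enn2real_mono)
qed (simp add: ennreal_powr_def)

context near_linear_family
begin

lemma fib_walk_le:
  assumes f: "f \<in> borel_measurable borel"
    and js: "distinct (k # i # js)" "set (k # i # js) = UNIV"
    and small: "\<eta> * end_err l w (Suc (length js)) < 1"
  shows "fib.fib i (walk js (\<lambda>x. f (p k x))) y \<le>
    ennreal ((1 / (1 - \<eta> * end_err l w (Suc (length js)))) ^ CARD('n) / \<bar>det (column_matrix w)\<bar>) * (\<integral>\<^sup>+y. f y \<partial>lborel)"
proof (cases "\<exists>s. (y, s) \<in> fib.W i")
  case False
  then show ?thesis by (simp add: fib.fib_def)
next
  case True
  let ?D = "\<bar>det (column_matrix w)\<bar>"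
  let ?T = "(1 / (1 - \<eta> * end_err l w (Suc (length js)))) ^ CARD('n)"
  have D: "?D > 0" using det_column_matrix by simp
  have T: "?T \<ge> 0" using small by simp
  obtain s where s: "(y, s) \<in> fib.W i" using True by blast
  define x where "x = fib.\<Psi> i (y, s)"
  have x: "x \<in> V" unfolding x_def using s by (rule fib.\<Psi>_in)
  have "fib.\<Phi> i x = (y, s)" unfolding x_def using s by (rule fib.\<Phi>_\<Psi>)
  then have y: "p i x = y" by (simp add: fib.\<Phi>_def)
  have "ennreal ?D * walk (i # js) (\<lambda>x. f (p k x)) x \<le> ennreal ?T * (\<integral>\<^sup>+y. f y \<partial>lborel)"
    using walk_le[OF x f, of k "i # js"] js small by simp
  then have "ennreal (1 / ?D) * (ennreal ?D * walk (i # js) (\<lambda>x. f (p k x)) x)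
      \<le> ennreal (1 / ?D) * (ennreal ?T * (\<integral>\<^sup>+y. f y \<partial>lborel))"
    by (rule mult_left_mono) simp
  moreover have "ennreal (1 / ?D) * ennreal ?D = 1"
    using D by (simp add: ennreal_mult[symmetric])
  moreover have "ennreal (1 / ?D) * ennreal ?T = ennreal (?T / ?D)"
    using D T by (simp add: ennreal_mult[symmetric])
  ultimately show ?thesis
    by (simp add: mult.assoc[symmetric] y)
qed

text \<open>
Two of the families are singled out: the walk starts from data of family \<open>i\<close> and ends with data of
family \<open>k\<close>. The lower bound for walks along the other families requires \<open>f i \<circ> p i\<close> to be bounded, which is
arranged by restricting to \<open>{f i (p i x) \<le> N}\<close>. Letting \<open>N\<close> tend to infinity loses only the set where
\<open>f i (p i x)\<close> is infinite; that set is negligible if \<open>f i\<close> is integrable, and otherwise the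
right-hand side is infinite unless some \<open>f j\<close> vanishes almost everywhere, when both sides are zero.
\<close>

lemma loomis_whitney_power:
  fixes f :: "'n \<Rightarrow> real ^ 'm \<Rightarrow> ennreal"
  assumes f: "\<And>j. f j \<in> borel_measurable borel"
    and small: "\<eta> * end_err l w CARD('m) < 1"
  defines "T \<equiv> (1 / (1 - \<eta>)) ^ (CARD('n) * (3 * CARD('m) - 2)) * (1 / (1 - \<eta> * end_err l w CARD('m))) ^ CARD('n)"
  shows "(\<integral>\<^sup>+x. indicator V x * (\<Prod>j\<in>UNIV. ennreal_powr (f j (p j x)) (1 / real CARD('m))) \<partial>lborel) ^ CARD('m)
    \<le> ennreal (T / \<bar>det (column_matrix w)\<bar>) * (\<Prod>j\<in>UNIV. \<integral>\<^sup>+y. f j y \<partial>lborel)"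
proof -
  let ?M = "density lborel (indicator V)"
  let ?m = "CARD('m)"
  let ?D = "\<bar>det (column_matrix w)\<bar>"
  let ?c = "ennreal ((1 / (1 - \<eta>)) ^ CARD('n))"
  let ?E = "ennreal ((1 / (1 - \<eta> * end_err l w ?m)) ^ CARD('n) / ?D)"
  let ?R = "ennreal (T / ?D) * (\<Prod>j\<in>UNIV. \<integral>\<^sup>+y. f j y \<partial>lborel)"
  define \<phi> where "\<phi> x = (\<Prod>j\<in>UNIV. ennreal_powr (f j (p j x)) (1 / real ?m))" for x
  have m: "?m > 0" by simp
  have D: "?D > 0" using det_column_matrix by simp
  have T: "T > 0"
    unfolding T_def using small \<eta>_half by simp
  note [measurable] = f fib.p
  have [measurable]: "V \<in> sets borel" using fib.open_V by simp
  have fp: "(\<lambda>x. f j (p j x)) \<in> borel_measurable borel" for j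
    by measurable
  have \<phi>[measurable]: "\<phi> \<in> borel_measurable borel"
    unfolding \<phi>_def[abs_def] by measurable
  have \<phi>_pow: "\<phi> x ^ ?m = (\<Prod>j\<in>UNIV. f j (p j x))" for x
    unfolding \<phi>_def using m by (simp add: prod_power_distrib ennreal_powr_root_power)
  have int_M: "(\<integral>\<^sup>+x. indicator V x * h x \<partial>lborel) = (\<integral>\<^sup>+x. h x \<partial>?M)" if "h \<in> borel_measurable borel" for h :: "real ^ 'n \<Rightarrow> ennreal"
    using that by (simp add: nn_integral_density)
  have main: "(\<integral>\<^sup>+x. \<phi> x \<partial>?M) ^ ?m \<le> ?R"
  proof (cases "\<exists>j. (\<integral>\<^sup>+y. f j y \<partial>lborel) = 0")
    case True
    then obtain j where j: "(\<integral>\<^sup>+y. f j y \<partial>lborel) = 0" by blast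
    then have AE0: "AE y in lborel. f j y = 0"
      by (subst (asm) nn_integral_0_iff_AE) simp_all
    then have "AE y in lborel. f j y * fib.fib j (\<lambda>_. 1) y = 0"
      by eventually_elim simp
    then have "(\<integral>\<^sup>+y. f j y * fib.fib j (\<lambda>_. 1) y \<partial>lborel) = 0"
      using fib.fib_measurable[of "\<lambda>_. 1" j]
      by (subst nn_integral_0_iff_AE) simp_all
    then have "(\<integral>\<^sup>+x. f j (p j x) \<partial>?M) = 0"
      using le_fibre[of "f j" "\<lambda>_. 1" j] by simp
    then have "AE x in ?M. f j (p j x) = 0"
      by (subst (asm) nn_integral_0_iff_AE) simp_all
    then have "AE x in ?M. \<phi> x = 0"
    proof eventually_elim
      case (elim x)
      then have "\<phi> x ^ ?m = 0"
        unfolding \<phi>_pow by (auto intro: prod_zero)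
      then show ?case by simp
    qed
    then have "(\<integral>\<^sup>+x. \<phi> x \<partial>?M) = 0"
      by (subst nn_integral_0_iff_AE) simp_all
    then show ?thesis by (simp add: zero_power)
  next
    case nonzero: False
    show ?thesis
    proof (cases "\<exists>j. (\<integral>\<^sup>+y. f j y \<partial>lborel) = top")
      case True
      then obtain j where j: "(\<integral>\<^sup>+y. f j y \<partial>lborel) = top" by blast
      have "(\<Prod>j\<in>UNIV. \<integral>\<^sup>+y. f j y \<partial>lborel) = top"
        using j nonzero by (subst ennreal_prod_eq_top) auto
      then have "?R = top"
        using T D by (simp add: ennreal_mult_top)
      then show ?thesis by simp
    next
      case finite: False
      obtain xs :: "'n list" where xs: "distinct xs" "set xs = UNIV"
        using finite_distinct_list[of "UNIV :: 'n set"] by auto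
      have "length xs = Suc ?m"
        using xs fib.card distinct_card[OF xs(1)] by simp
      then obtain k xs' where "xs = k # xs'" "length xs' = ?m"
        by (auto simp: length_Suc_conv)
      moreover obtain i js where "xs' = i # js"
        using m \<open>length xs' = ?m\<close> by (cases xs') auto
      ultimately have js: "distinct (k # i # js)" "set (k # i # js) = UNIV" and len: "Suc (length js) = ?m"
        using xs by auto
      have split: "(\<Prod>j\<in>UNIV. g j) = g i * g k * (\<Prod>j\<leftarrow>js. g j)" for g :: "'n \<Rightarrow> ennreal"
        unfolding js(2)[symmetric] prod.distinct_set_conv_list[OF js(1)] by (simp add: mult_ac)
      define B where "B x = f k (p k x)" for x
      have B[measurable]: "B \<in> borel_measurable borel"
        unfolding B_def[abs_def] by measurable
      have walk_meas: "walk js B \<in> borel_measurable ?M"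
        using B by (intro measurable_walk) simp
      define \<phi>' where "\<phi>' N x = \<phi> x * indicator {x. f i (p i x) \<le> of_nat N} x" for N :: nat and x
      have [measurable]: "\<phi>' N \<in> borel_measurable borel" for N
        unfolding \<phi>'_def[abs_def] by measurable
      have bound: "(\<integral>\<^sup>+x. \<phi>' N x \<partial>?M) ^ ?m \<le> ?R" for N
      proof -
        define A where "A x = f i (p i x) * indicator {x. f i (p i x) \<le> of_nat N} x" for x
        have [measurable]: "A \<in> borel_measurable borel"
          unfolding A_def[abs_def] by measurable
        have le: "\<phi>' N x ^ Suc (length js) \<le> A x * B x * (\<Prod>j\<leftarrow>js. f j (p j x))" for x
        proof -
          have "\<phi>' N x ^ Suc (length js) = \<phi> x ^ ?m * indicator {x. f i (p i x) \<le> of_nat N} x"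
            unfolding len \<phi>'_def using m by (simp add: indicator_def)
          then show ?thesis
            by (simp add: \<phi>_pow split A_def B_def mult_ac)
        qed
        have "(\<integral>\<^sup>+x. \<phi>' N x \<partial>?M) ^ Suc (length js) \<le>
            ?c ^ (3 * length js) * (\<Prod>j\<leftarrow>js. \<integral>\<^sup>+y. f j y \<partial>lborel) * (\<integral>\<^sup>+x. A x * walk js B x \<partial>?M)"
        proof (rule integral_power_le_walk[where C = "of_nat N" and w = "\<phi>' N" and f = f])
          show "A x \<le> of_nat N" for x
            by (simp add: A_def indicator_def)
          show "of_nat N < (top :: ennreal)"
            by (simp add: less_top[symmetric])
        qed (simp_all add: le del: power_Suc)
        also have "\<dots> \<le> ?c ^ (3 * length js) * (\<Prod>j\<leftarrow>js. \<integral>\<^sup>+y. f j y \<partial>lborel) *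
            (?c * (?E * (\<integral>\<^sup>+y. f k y \<partial>lborel) * (\<integral>\<^sup>+y. f i y \<partial>lborel)))"
        proof (rule mult_left_mono)
          have "(\<integral>\<^sup>+x. A x * walk js B x \<partial>?M) \<le> (\<integral>\<^sup>+x. f i (p i x) * walk js B x \<partial>?M)"
            by (intro nn_integral_mono mult_right_mono) (simp_all add: A_def indicator_def)
          also have "\<dots> \<le> ?c * (\<integral>\<^sup>+y. f i y * fib.fib i (walk js B) y \<partial>lborel)"
            using walk_meas by (intro le_fibre) simp_all
          also have "\<dots> \<le> ?c * (\<integral>\<^sup>+y. f i y * (?E * (\<integral>\<^sup>+y. f k y \<partial>lborel)) \<partial>lborel)"
            unfolding B_def[abs_def] using fib_walk_le[OF f[of k] js] small
            by (intro mult_left_mono nn_integral_mono) (simp_all add: len)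
          also have "(\<integral>\<^sup>+y. f i y * (?E * (\<integral>\<^sup>+y. f k y \<partial>lborel)) \<partial>lborel)
              = ?E * (\<integral>\<^sup>+y. f k y \<partial>lborel) * (\<integral>\<^sup>+y. f i y \<partial>lborel)"
            by (subst nn_integral_multc) (simp_all add: mult_ac)
          finally show "(\<integral>\<^sup>+x. A x * walk js B x \<partial>?M) \<le> ?c * (?E * (\<integral>\<^sup>+y. f k y \<partial>lborel) * (\<integral>\<^sup>+y. f i y \<partial>lborel))" .
        qed simp
        also have "\<dots> = ?c ^ (3 * length js + 1) * ?E * (\<Prod>j\<in>UNIV. \<integral>\<^sup>+y. f j y \<partial>lborel)"
          by (simp add: split mult_ac)
        also have "?c ^ (3 * length js + 1) * ?E = ennreal (T / ?D)"
        proof -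
          have "3 * length js + 1 = 3 * ?m - 2" using len by linarith
          then show ?thesis
            using \<eta>_half small D
            by (simp add: T_def ennreal_power ennreal_mult[symmetric] power_mult)
        qed
        finally show ?thesis by (simp add: len)
      qed
      have fin: "AE x in ?M. f i (p i x) \<noteq> top"
      proof -
        have "AE y in lborel. f i y \<noteq> top"
          using nn_integral_PInf_AE[of "f i" lborel] finite by simp
        then have "AE y in lborel. indicator {y. f i y = top} y * fib.fib i (\<lambda>_. 1) y = 0"
          by eventually_elim simp
        then have "(\<integral>\<^sup>+y. indicator {y. f i y = top} y * fib.fib i (\<lambda>_. 1) y \<partial>lborel) = 0"
          using fib.fib_measurable[of "\<lambda>_. 1" i]
          by (subst nn_integral_0_iff_AE) simp_all
        then have "(\<integral>\<^sup>+x. indicator {y. f i y = top} (p i x) \<partial>?M) = 0"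
          using le_fibre[of "indicator {y. f i y = top}" "\<lambda>_. 1" i] by simp
        then have "AE x in ?M. indicator {y. f i y = top} (p i x) = (0::ennreal)"
          by (subst (asm) nn_integral_0_iff_AE) simp_all
        then show ?thesis
          by eventually_elim (simp split: split_indicator_asm)
      qed
      have "(\<integral>\<^sup>+x. \<phi> x \<partial>?M) = (\<integral>\<^sup>+x. (SUP N. \<phi>' N x) \<partial>?M)"
      proof (rule nn_integral_cong_AE)
        show "AE x in ?M. \<phi> x = (SUP N. \<phi>' N x)"
          using fin
        proof eventually_elim
          case (elim x)
          then obtain N :: nat where "f i (p i x) < of_nat N"
            using ennreal_Ex_less_of_nat[of "f i (p i x)"] by (auto simp: less_top)
          then have "f i (p i x) \<le> of_nat N"
            by (rule less_imp_le)
          then have "\<phi> x \<le> (SUP N. \<phi>' N x)"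
            by (intro SUP_upper2[of N]) (simp_all add: \<phi>'_def)
          moreover have "(SUP N. \<phi>' N x) \<le> \<phi> x"
            by (intro SUP_least) (simp add: \<phi>'_def indicator_def)
          ultimately show ?case by (rule antisym)
        qed
      qed
      also have "\<dots> = (SUP N. \<integral>\<^sup>+x. \<phi>' N x \<partial>?M)"
      proof (rule nn_integral_monotone_convergence_SUP)
        show "incseq \<phi>'"
        proof (intro incseq_SucI le_funI)
          fix N x
          have N: "of_nat N \<le> (of_nat (Suc N) :: ennreal)"
            by (rule of_nat_mono) simp
          show "\<phi>' N x \<le> \<phi>' (Suc N) x"
          proof (cases "f i (p i x) \<le> of_nat N")
            case True
            with order_trans[OF this N] show ?thesis by (simp add: \<phi>'_def)
          qed (simp add: \<phi>'_def)
        qed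
      qed simp
      also have "\<dots> \<le> ennreal_powr ?R (1 / real ?m)"
      proof (rule SUP_least)
        fix N
        show "(\<integral>\<^sup>+x. \<phi>' N x \<partial>?M) \<le> ennreal_powr ?R (1 / real ?m)"
        proof (rule power_le_imp_le_ennreal[where n = ?m])
          show "(\<integral>\<^sup>+x. \<phi>' N x \<partial>?M) ^ ?m \<le> ennreal_powr ?R (1 / real ?m) ^ ?m"
            using bound[of N] by (simp add: ennreal_powr_root_power)
        qed simp
      qed
      finally have "(\<integral>\<^sup>+x. \<phi> x \<partial>?M) ^ ?m \<le> ennreal_powr ?R (1 / real ?m) ^ ?m"
        by (rule power_mono) simp
      then show ?thesis
        using m by (simp add: ennreal_powr_root_power)
    qed
  qed
  then show ?thesis
    unfolding int_M[OF \<phi>, symmetric] by (simp add: \<phi>_def)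
qed

end

section \<open>Passage to submersions of class C1\<close>

lemma norm_matrix_vector_mult_le:
  fixes A :: "real ^ 'n ^ 'm"
  shows "norm (A *v x) \<le> norm A * norm x"
proof -
  have "norm (A *v x) \<le> L2_set (\<lambda>i. norm (A $ i) * norm x) UNIV"
    unfolding norm_vec_def[of "A *v x"]
  proof (rule L2_set_mono)
    fix i
    have "(A *v x) $ i = A $ i \<bullet> x"
      by (simp add: matrix_vector_mult_def inner_vec_def)
    then show "norm ((A *v x) $ i) \<le> norm (A $ i) * norm x"
      by (simp add: Cauchy_Schwarz_ineq2)
  qed simp
  also have "\<dots> = norm A * norm x"
    unfolding norm_vec_def[of A] by (simp add: L2_set_left_distrib)
  finally show ?thesis .
qed

text \<open>
The mean value inequality applied to \<open>\<pi> j\<close> minus its differential at the origin.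
\<close>

lemma C1_near_linear:
  fixes \<pi> :: "'i::finite \<Rightarrow> real ^ 'n \<Rightarrow> real ^ 'm"
  assumes V: "open V" "0 \<in> V" and C1: "\<And>j. C1_submersion_on (\<pi> j) V" and \<delta>: "\<delta> > 0"
  obtains r where "r > 0" "ball 0 r \<subseteq> V"
    "\<And>j x y. x \<in> ball 0 r \<Longrightarrow> y \<in> ball 0 r \<Longrightarrow>
      norm (\<pi> j x - \<pi> j y - jacobian (\<pi> j) (at 0) *v (x - y)) \<le> \<delta> * norm (x - y)"
proof -
  let ?J = "\<lambda>j x. jacobian (\<pi> j) (at x)"
  have "\<forall>\<^sub>F x in nhds 0. x \<in> V \<and> norm (?J j x - ?J j 0) < \<delta>" for j
  proof -
    have "continuous_on V (?J j)"
      using C1[of j] by (simp add: C1_submersion_on_def)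
    then have "isCont (?J j) 0"
      using V by (simp add: continuous_on_eq_continuous_at)
    then have "(?J j \<longlongrightarrow> ?J j 0) (nhds 0)"
      using tendsto_at_iff_tendsto_nhds[of "?J j" 0] by (simp add: continuous_at)
    then have "\<forall>\<^sub>F x in nhds 0. dist (?J j x) (?J j 0) < \<delta>"
      using \<delta> by (rule tendstoD)
    moreover have "\<forall>\<^sub>F x in nhds 0. x \<in> V"
      using V by (rule eventually_nhds_in_open)
    ultimately show ?thesis
      by eventually_elim (simp add: dist_norm)
  qed
  then have "\<forall>\<^sub>F x in nhds 0. \<forall>j\<in>UNIV. x \<in> V \<and> norm (?J j x - ?J j 0) < \<delta>"
    by (intro eventually_ball_finite) simp_all
  then obtain r where r: "r > 0" "\<And>x j. dist x 0 < r \<Longrightarrow> x \<in> V \<and> norm (?J j x - ?J j 0) < \<delta>"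
    unfolding eventually_nhds_metric by auto
  show thesis
  proof (rule that[OF r(1)])
    show "ball 0 r \<subseteq> V" using r(2) by (auto simp: dist_commute)
    fix j x y assume xy: "x \<in> ball (0 :: real ^ 'n) r" "y \<in> ball (0 :: real ^ 'n) r"
    let ?f = "\<lambda>x. \<pi> j x - ?J j 0 *v x"
    have "norm (?f x - ?f y) \<le> \<delta> * norm (x - y)"
    proof (rule differentiable_bound[where f' = "\<lambda>x h. (?J j x - ?J j 0) *v h"])
      fix z assume "z \<in> ball (0 :: real ^ 'n) r"
      then have z: "z \<in> V" "norm (?J j z - ?J j 0) < \<delta>"
        using r(2)[of z j] by (auto simp: dist_commute)
      have "\<pi> j differentiable (at z)"
        using C1[of j] z(1) by (simp add: C1_submersion_on_def)
      then have "(\<pi> j has_derivative (\<lambda>h. ?J j z *v h)) (at z)"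
        by (simp add: jacobian_works)
      then have "(?f has_derivative (\<lambda>h. ?J j z *v h - ?J j 0 *v h)) (at z within ball 0 r)"
        by (intro has_derivative_diff bounded_linear_imp_has_derivative matrix_vector_mul_bounded_linear)
           (rule has_derivative_at_withinI)
      then show "(?f has_derivative (\<lambda>h. (?J j z - ?J j 0) *v h)) (at z within ball 0 r)"
        by (simp add: matrix_vector_mult_diff_rdistrib)
      show "onorm (\<lambda>h. (?J j z - ?J j 0) *v h) \<le> \<delta>"
      proof (rule onorm_le)
        fix h
        show "norm ((?J j z - ?J j 0) *v h) \<le> \<delta> * norm h"
          using norm_matrix_vector_mult_le[of "?J j z - ?J j 0" h] z(2)
          by (meson less_imp_le mult_right_mono norm_ge_zero order_trans)
      qed
    qed (use xy in auto)
    then show "norm (\<pi> j x - \<pi> j y - ?J j 0 *v (x - y)) \<le> \<delta> * norm (x - y)"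
      by (simp add: matrix_vector_mult_diff_distrib algebra_simps)
  qed
qed

text \<open>
Composition of a Lebesgue measurable \<open>f\<close> with a submersion is awkward because null sets have to be
pulled back. Enlarging \<open>f\<close> to \<open>\<infinity>\<close> on a Borel null set makes it Borel everywhere without changing its
integral, and enlarging can only strengthen the inequality.
\<close>

lemma lebesgue_majorant:
  fixes f :: "'a::euclidean_space \<Rightarrow> ennreal"
  assumes U: "U \<in> sets borel" and f: "f \<in> borel_measurable (lebesgue_on U)"
  obtains g where "g \<in> borel_measurable borel" "\<And>y. y \<in> U \<Longrightarrow> f y \<le> g y"
    "(\<integral>\<^sup>+y. g y \<partial>lborel) = (\<integral>\<^sup>+y. f y \<partial>lebesgue_on U)"
proof -
  let ?F = "\<lambda>y. f y * indicator U y"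
  have UL: "U \<inter> space lebesgue \<in> sets lebesgue" using U by simp
  have F: "?F \<in> borel_measurable (completion lborel)"
    using f borel_measurable_restrict_space_iff_ennreal[OF UL] by blast
  then obtain g' where g': "g' \<in> borel_measurable lborel" "AE y in lborel. ?F y = g' y"
    using completion_ex_borel_measurable by blast
  obtain N where N: "{y \<in> space lborel. \<not> ?F y = g' y} \<subseteq> N" "N \<in> null_sets lborel"
    using AE_E[OF g'(2)] by (metis null_setsI)
  define g where "g y = (if y \<in> N then top else g' y)" for y
  have "g \<in> borel_measurable borel"
    unfolding g_def[abs_def] using g'(1) N(2) by (intro measurable_If_set) auto
  moreover have "f y \<le> g y" if "y \<in> U" for y
  proof (cases "y \<in> N")
    case False
    then have "?F y = g' y" using N(1) by auto
    then show ?thesis using that False by (simp add: g_def)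
  qed (simp add: g_def)
  moreover have "(\<integral>\<^sup>+y. g y \<partial>lborel) = (\<integral>\<^sup>+y. f y \<partial>lebesgue_on U)"
  proof -
    have "AE y in lborel. g y = ?F y"
      using g'(2) AE_not_in[OF N(2)] by eventually_elim (simp add: g_def)
    then have "(\<integral>\<^sup>+y. g y \<partial>lborel) = (\<integral>\<^sup>+y. ?F y \<partial>lborel)"
      by (rule nn_integral_cong_AE)
    also have "\<dots> = (\<integral>\<^sup>+y. ?F y \<partial>lebesgue)"
      by (simp add: nn_integral_completion)
    also have "\<dots> = (\<integral>\<^sup>+y. f y \<partial>lebesgue_on U)"
      using UL by (simp add: nn_integral_restrict_space)
    finally show ?thesis .
  qed
  ultimately show thesis by (rule that)
qed

text \<open>
The rows of the inverse matrix.
\<close>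

lemma dual_frame:
  fixes w :: "'n::finite \<Rightarrow> real ^ 'n"
  assumes "det (column_matrix w) \<noteq> 0"
  obtains l where "\<And>i j. l i \<bullet> w j = (if i = j then 1 else 0)"
proof
  let ?B = "matrix_inv (column_matrix w)"
  fix i j
  have "?B $ i \<bullet> w j = (?B ** column_matrix w) $ i $ j"
    by (simp add: matrix_matrix_mult_def column_matrix_def inner_vec_def)
  then show "(\<lambda>i. ?B $ i) i \<bullet> w j = (if i = j then 1 else 0)"
    by (simp add: matrix_inv_mult[OF assms] mat_def)
qed

lemma small_distortion:
  fixes \<epsilon> E :: real
  assumes "\<epsilon> > 0"
  obtains \<eta> where "0 < \<eta>" "\<eta> \<le> 1 / 2" "\<eta> * E < 1"
    "(1 / (1 - \<eta>)) ^ a * (1 / (1 - \<eta> * E)) ^ b \<le> 1 + \<epsilon>"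
proof -
  have "((\<lambda>\<eta>. (1 / (1 - \<eta>)) ^ a * (1 / (1 - \<eta> * E)) ^ b) \<longlongrightarrow> (1 / (1 - 0)) ^ a * (1 / (1 - 0 * E)) ^ b) (at_right (0::real))"
    by (intro tendsto_intros) simp_all
  from order_tendstoD(2)[OF this, of "1 + \<epsilon>"]
  have "\<forall>\<^sub>F \<eta> in at_right (0::real). (1 / (1 - \<eta>)) ^ a * (1 / (1 - \<eta> * E)) ^ b < 1 + \<epsilon>"
    using assms by simp
  moreover have "((\<lambda>\<eta>. \<eta> * E) \<longlongrightarrow> 0 * E) (at_right (0::real))"
    by (intro tendsto_intros)
  from order_tendstoD(2)[OF this, of 1] have "\<forall>\<^sub>F \<eta> in at_right (0::real). \<eta> * E < 1"
    by simp
  moreover have "\<forall>\<^sub>F \<eta> in at_right (0::real). \<eta> \<in> {0<..<1/2}"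
    by (intro eventually_at_right_real) simp
  ultimately have "\<forall>\<^sub>F \<eta> in at_right (0::real). \<eta> \<in> {0<..<1/2} \<and> \<eta> * E < 1 \<and>
      (1 / (1 - \<eta>)) ^ a * (1 / (1 - \<eta> * E)) ^ b < 1 + \<epsilon>"
    by eventually_elim simp
  then obtain \<eta> where "\<eta> \<in> {0<..<1/2}" "\<eta> * E < 1" "(1 / (1 - \<eta>)) ^ a * (1 / (1 - \<eta> * E)) ^ b < 1 + \<epsilon>"
    using eventually_happens'[OF trivial_limit_at_right_real] by blast
  then show thesis by (intro that[of \<eta>]) simp_all
qed

theorem corollary9p3:
  fixes n :: nat
    and V :: "(real ^ 'n) set" and U :: "(real ^ 'm) set"
    and \<pi> :: "'n \<Rightarrow> real ^ 'n \<Rightarrow> real ^ 'm"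
    and \<omega> :: "'n \<Rightarrow> real ^ 'n \<Rightarrow> real ^ 'n"
  assumes "n \<ge> 2" and "CARD('n) = n" and "CARD('m) = n - 1"
    and "open V" and "0 \<in> V" and "open U" and "0 \<in> U"
    and "\<And>j. C1_submersion_on (\<pi> j) V" and "\<And>j. \<pi> j ` V = U"
    and "\<And>j x. x \<in> V \<Longrightarrow> \<omega> j x = wedge_rows (jacobian (\<pi> j) (at x))"
    and "wedge_modulus (\<lambda>j. \<omega> j 0) \<noteq> 0"
  shows "\<forall>\<epsilon>>0. \<exists>V'. open V' \<and> 0 \<in> V' \<and> V' \<subseteq> V \<and>
    (\<forall>f :: 'n \<Rightarrow> real ^ 'm \<Rightarrow> ennreal.
       (\<forall>j. f j \<in> borel_measurable (lebesgue_on U)) \<longrightarrow>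
       (\<integral>\<^sup>+ x. (\<Prod>j\<in>UNIV. ennreal_powr (f j (\<pi> j x)) (1 / (real n - 1))) \<partial>lebesgue_on V')
       \<le> ennreal ((1 + \<epsilon>) * wedge_modulus (\<lambda>j. \<omega> j 0) powr (- (1 / (real n - 1)))) *
         (\<Prod>j\<in>UNIV. ennreal_powr (\<integral>\<^sup>+ y. f j y \<partial>lebesgue_on U) (1 / (real n - 1))))"
proof (intro allI impI)
  fix \<epsilon> :: real assume \<epsilon>: "\<epsilon> > 0"
  let ?m = "CARD('m)"
  have card: "CARD('n) = Suc ?m" and exponent: "real n - 1 = real ?m"
    using assms(1-3) by (simp_all add: of_nat_diff)
  define A where "A j = jacobian (\<pi> j) (at 0)" for j
  define w where "w j = \<omega> j 0" for j
  have w: "w j = wedge_rows (A j)" for j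
    using assms(5,10) by (simp add: w_def A_def)
  have D: "wedge_modulus (\<lambda>j. \<omega> j 0) = \<bar>det (column_matrix w)\<bar>"
    by (simp add: wedge_modulus_def column_matrix_def w_def)
  let ?D = "\<bar>det (column_matrix w)\<bar>"
  have D_pos: "?D > 0" using assms(11) unfolding D by simp
  then have "det (column_matrix w) \<noteq> 0" by simp
  then obtain l where l: "\<And>i j. l i \<bullet> w j = (if i = j then 1 else 0)"
    using dual_frame by blast
  let ?E = "end_err l w ?m"
  obtain \<eta> where \<eta>: "0 < \<eta>" "\<eta> \<le> 1 / 2" "\<eta> * ?E < 1"
    "(1 / (1 - \<eta>)) ^ (CARD('n) * (3 * ?m - 2)) * (1 / (1 - \<eta> * ?E)) ^ CARD('n) \<le> 1 + \<epsilon>"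
    using small_distortion[OF \<epsilon>] by blast
  let ?T = "(1 / (1 - \<eta>)) ^ (CARD('n) * (3 * ?m - 2)) * (1 / (1 - \<eta> * ?E)) ^ CARD('n)"
  obtain B where B: "B > 0" "\<And>j z. norm (coords_inv (A j) (l j) z) \<le> B * norm z"
  proof -
    have "\<exists>b>0. \<forall>z. norm (coords_inv (A j) (l j) z) \<le> b * norm z" for j
      using linear_coords_inv[of "A j" "l j"] linear_bounded_pos by blast
    then obtain b where b: "\<And>j. b j > 0" "\<And>j z. norm (coords_inv (A j) (l j) z) \<le> b j * norm z"
      by metis
    show thesis
    proof (rule that[of "\<Sum>j\<in>UNIV. b j"])
      show "(\<Sum>j\<in>UNIV. b j) > 0" using b(1) by (intro sum_pos) auto
      fix j z
      have "b j \<le> (\<Sum>j\<in>UNIV. b j)"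
        using b(1) by (intro member_le_sum) (auto simp: less_imp_le)
      then show "norm (coords_inv (A j) (l j) z) \<le> (\<Sum>j\<in>UNIV. b j) * norm z"
        using b(2)[of j z] mult_right_mono[of "b j" _ "norm z"] by force
    qed
  qed
  obtain r where r: "r > 0" "ball 0 r \<subseteq> V"
    "\<And>j x y. x \<in> ball 0 r \<Longrightarrow> y \<in> ball 0 r \<Longrightarrow>
      norm (\<pi> j x - \<pi> j y - A j *v (x - y)) \<le> \<eta> / B * norm (x - y)"
  proof (rule C1_near_linear[of V \<pi> "\<eta> / B", OF assms(4,5) assms(8)])
    show "\<eta> / B > 0" using \<eta>(1) B(1) by simp
  qed (use that in \<open>simp add: A_def\<close>)
  let ?V = "ball 0 r :: (real ^ 'n) set"
  \<comment> \<open>Only values on the ball matter; cutting off outside makes the maps Borel on the whole space.\<close>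
  define p where "p j x = (if x \<in> ?V then \<pi> j x else 0)" for j x
  have p: "p j \<in> borel_measurable borel" for j
  proof -
    have "\<pi> j differentiable (at x)" if "x \<in> ?V" for x
      using assms(8)[of j] r(2) that by (auto simp: C1_submersion_on_def)
    then have "continuous_on ?V (\<pi> j)"
      by (intro continuous_at_imp_continuous_on ballI differentiable_imp_continuous_within) simp
    then show ?thesis
      unfolding p_def[abs_def] by (intro borel_measurable_continuous_on_if) simp_all
  qed
  interpret near_linear_family ?V p A l w \<eta>
  proof (rule near_linear_family.intro)
    fix i j
    show "near_linear_fibration ?V (p j) (A j) (l j) \<eta>"
    proof
      show "CARD('n) = Suc ?m" "open ?V" "bounded ?V" "0 \<le> \<eta>" "\<eta> < 1" "p j \<in> borel_measurable borel"
        using card \<eta> p by simp_all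
      show "\<bar>det (stack (A j) (l j))\<bar> = 1"
        by (simp add: det_stack[OF card] w[symmetric] l)
      fix x y assume xy: "x \<in> ?V" "y \<in> ?V"
      have "norm (coords_inv (A j) (l j) (p j x - p j y - A j *v (x - y), 0))
          \<le> B * norm (p j x - p j y - A j *v (x - y), 0 :: real)"
        by (rule B(2))
      also have "\<dots> \<le> B * (\<eta> / B * norm (x - y))"
        using r(3)[OF xy, of j] B(1) xy by (intro mult_left_mono) (simp_all add: p_def norm_Pair)
      finally show "norm (coords_inv (A j) (l j) (p j x - p j y - A j *v (x - y), 0)) \<le> \<eta> * norm (x - y)"
        using B(1) by simp
    qed
    show "\<eta> \<le> 1 / 2" by (rule \<eta>)
    show "l i \<bullet> w j = (if i = j then 1 else 0)" by (rule l)
    show "A j *v w j = 0" unfolding w by (rule wedge_rows_kernel[OF card])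
  qed
  show "\<exists>V'. open V' \<and> 0 \<in> V' \<and> V' \<subseteq> V \<and>
    (\<forall>f :: 'n \<Rightarrow> real ^ 'm \<Rightarrow> ennreal.
       (\<forall>j. f j \<in> borel_measurable (lebesgue_on U)) \<longrightarrow>
       (\<integral>\<^sup>+ x. (\<Prod>j\<in>UNIV. ennreal_powr (f j (\<pi> j x)) (1 / (real n - 1))) \<partial>lebesgue_on V')
       \<le> ennreal ((1 + \<epsilon>) * wedge_modulus (\<lambda>j. \<omega> j 0) powr (- (1 / (real n - 1)))) *
         (\<Prod>j\<in>UNIV. ennreal_powr (\<integral>\<^sup>+ y. f j y \<partial>lebesgue_on U) (1 / (real n - 1))))"
  proof (intro exI[of _ ?V] conjI allI impI)
    show "open ?V" "0 \<in> ?V" "?V \<subseteq> V" using r by auto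
    fix f :: "'n \<Rightarrow> real ^ 'm \<Rightarrow> ennreal"
    assume f: "\<forall>j. f j \<in> borel_measurable (lebesgue_on U)"
    have "\<exists>g. g \<in> borel_measurable borel \<and> (\<forall>y\<in>U. f j y \<le> g y) \<and>
        (\<integral>\<^sup>+y. g y \<partial>lborel) = (\<integral>\<^sup>+y. f j y \<partial>lebesgue_on U)" for j
      using lebesgue_majorant[of U "f j"] f assms(6) by (metis borel_open)
    then obtain g where g: "\<And>j. g j \<in> borel_measurable borel" "\<And>j y. y \<in> U \<Longrightarrow> f j y \<le> g j y"
      "\<And>j. (\<integral>\<^sup>+y. g j y \<partial>lborel) = (\<integral>\<^sup>+y. f j y \<partial>lebesgue_on U)"
      by metis
    let ?a = "1 / real ?m"
    let ?L = "\<integral>\<^sup>+x. indicator ?V x * (\<Prod>j\<in>UNIV. ennreal_powr (g j (p j x)) ?a) \<partial>lborel"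
    let ?R = "ennreal ((1 + \<epsilon>) * ?D powr (- ?a)) * (\<Prod>j\<in>UNIV. ennreal_powr (\<integral>\<^sup>+ y. f j y \<partial>lebesgue_on U) ?a)"
    have "(\<integral>\<^sup>+ x. (\<Prod>j\<in>UNIV. ennreal_powr (f j (\<pi> j x)) ?a) \<partial>lebesgue_on ?V)
        = (\<integral>\<^sup>+ x. (\<Prod>j\<in>UNIV. ennreal_powr (f j (\<pi> j x)) ?a) * indicator ?V x \<partial>lebesgue)"
      by (rule nn_integral_restrict_space) simp
    also have "\<dots> \<le> (\<integral>\<^sup>+x. indicator ?V x * (\<Prod>j\<in>UNIV. ennreal_powr (g j (p j x)) ?a) \<partial>lebesgue)"
    proof (rule nn_integral_mono)
      fix x
      show "(\<Prod>j\<in>UNIV. ennreal_powr (f j (\<pi> j x)) ?a) * indicator ?V x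
          \<le> indicator ?V x * (\<Prod>j\<in>UNIV. ennreal_powr (g j (p j x)) ?a)"
      proof (cases "x \<in> ?V")
        case True
        then have "x \<in> V" using r(2) by auto
        have "f j (\<pi> j x) \<le> g j (p j x)" for j
        proof -
          have "\<pi> j x \<in> U" using \<open>x \<in> V\<close> assms(9)[of j] by blast
          then show ?thesis using g(2) True by (simp add: p_def)
        qed
        then show ?thesis
          using True by (simp add: prod_mono_ennreal ennreal_powr_mono)
      qed simp
    qed
    also have "\<dots> = ?L"
      by (simp add: nn_integral_completion)
    also have "?L \<le> ?R"
    proof (rule power_le_imp_le_ennreal[where n = ?m])
      have "?L ^ ?m \<le> ennreal (?T / ?D) * (\<Prod>j\<in>UNIV. \<integral>\<^sup>+y. g j y \<partial>lborel)"
        using g(1) \<eta>(3) by (rule loomis_whitney_power)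
      also have "\<dots> \<le> ennreal ((1 + \<epsilon>) ^ ?m / ?D) * (\<Prod>j\<in>UNIV. \<integral>\<^sup>+y. g j y \<partial>lborel)"
      proof (intro mult_right_mono ennreal_leI divide_right_mono)
        have "1 + \<epsilon> \<le> (1 + \<epsilon>) ^ ?m"
          using \<epsilon> by (intro self_le_power) simp_all
        then show "?T \<le> (1 + \<epsilon>) ^ ?m" using \<eta>(4) by simp
      qed simp_all
      also have "(1 + \<epsilon>) ^ ?m / ?D = ((1 + \<epsilon>) * ?D powr (- ?a)) ^ ?m"
      proof -
        have "(?D powr (- ?a)) ^ ?m = ?D powr (- 1)"
          using D_pos by (subst powr_power) simp_all
        also have "\<dots> = 1 / ?D"
          using D_pos by (rule powr_neg_one)
        finally show ?thesis
          by (simp only: power_mult_distrib) simp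
      qed
      also have "ennreal (((1 + \<epsilon>) * ?D powr (- ?a)) ^ ?m) * (\<Prod>j\<in>UNIV. \<integral>\<^sup>+y. g j y \<partial>lborel) = ?R ^ ?m"
      proof -
        have X: "ennreal (((1 + \<epsilon>) * ?D powr (- ?a)) ^ ?m) = ennreal ((1 + \<epsilon>) * ?D powr (- ?a)) ^ ?m"
          using \<epsilon> by (intro ennreal_power[symmetric]) simp
        have F: "ennreal_powr (\<integral>\<^sup>+y. f j y \<partial>lebesgue_on U) ?a ^ ?m = (\<integral>\<^sup>+y. g j y \<partial>lborel)" for j
          by (simp add: ennreal_powr_root_power g(3))
        show ?thesis
          unfolding X power_mult_distrib[of "ennreal _"] prod_power_distrib F ..
      qed
      finally show "?L ^ ?m \<le> ?R ^ ?m" .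
    qed simp
    finally show "(\<integral>\<^sup>+ x. (\<Prod>j\<in>UNIV. ennreal_powr (f j (\<pi> j x)) (1 / (real n - 1))) \<partial>lebesgue_on ?V)
       \<le> ennreal ((1 + \<epsilon>) * wedge_modulus (\<lambda>j. \<omega> j 0) powr (- (1 / (real n - 1)))) *
         (\<Prod>j\<in>UNIV. ennreal_powr (\<integral>\<^sup>+ y. f j y \<partial>lebesgue_on U) (1 / (real n - 1)))"
      unfolding D exponent .
  qed
qed

end
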